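(* The center $x^*$ of $\mathrm{MaxIE}(P)$ admits an open ball $U_{\mathrm{QG}}\subseteq\mathrm{int}(P)$ centered at $x^*$ and a constant $\mu>0$ such that $v(x)-v(x^* )\ge\mu\|x-x^*\|^2$ for all $x\in U_{\mathrm{QG}}$.
   Context: $P=\{x\in\mathbb R^n: a_i^\top x\le 1,\ i=1,\dots,m\}$ is a full-dimensional (bounded) polytope. For $c\in\mathbb R^n$ and $Q$ symmetric positive definite, $\mathcal E(c,Q)=\{y\in\mathbb R^n:(y-c)^\top Q(y-c)\le 1\}$, with normalized volume $\mathrm{Vol}(\mathcal E(c,Q))=\det(Q)^{-1/2}$. The polar of $S$ is $S^\circ=\{y: y^\top s\le1\ \forall s\in S\}$. $\mathrm{MinCE}(K)$ is the unique minimum-volume ellipsoid containing a full-dimensional compact set $K$; $\mathrm{MaxIE}(P)$ is the unique maximum-volume ellipsoid contained in $P$. For $x\in\mathrm{int}(P)$, $v(x)=\log\mathrm{Vol}(\mathrm{MinCE}((P-x)^\circ))$. *)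

theory Defs
  imports "HOL-Analysis.Analysis"
begin

definition sym_pos_def :: "real^'n^'n \<Rightarrow> bool" where
  "sym_pos_def Q \<longleftrightarrow> transpose Q = Q \<and> (\<forall>x. x \<noteq> 0 \<longrightarrow> x \<bullet> (Q *v x) > 0)"

definition ellipsoid :: "real^'n \<Rightarrow> real^'n^'n \<Rightarrow> (real^'n) set" where
  "ellipsoid c Q = {y. (y - c) \<bullet> (Q *v (y - c)) \<le> 1}"

definition is_ellipsoid :: "(real^'n) set \<Rightarrow> bool" where
  "is_ellipsoid E \<longleftrightarrow> (\<exists>c Q. sym_pos_def Q \<and> E = ellipsoid c Q)"

text \<open>Center and normalized volume are functions of the ellipsoid as a set; lemma
  \<open>ellipsoid_eq_iff\<close> below shows that the center and the matrix are determined by the set.\<close>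

definition ell_center :: "(real^'n) set \<Rightarrow> real^'n" where
  "ell_center E = (THE c. \<exists>Q. sym_pos_def Q \<and> E = ellipsoid c Q)"

definition ell_vol :: "(real^'n) set \<Rightarrow> real" where
  "ell_vol E = (THE v. \<exists>c Q. sym_pos_def Q \<and> E = ellipsoid c Q \<and> v = det Q powr (-1/2))"

definition polar :: "(real^'n) set \<Rightarrow> (real^'n) set" where
  "polar S = {y. \<forall>s\<in>S. y \<bullet> s \<le> 1}"

text \<open>The two extremal ellipsoids exist and are unique for full-dimensional compact
  (and, for \<open>MaxIE\<close>, convex) sets; outside that case the descriptions are unspecified.\<close>

definition MinCE :: "(real^'n) set \<Rightarrow> (real^'n) set" where
  "MinCE K = (THE E. is_ellipsoid E \<and> K \<subseteq> E \<and>
     (\<forall>F. is_ellipsoid F \<and> K \<subseteq> F \<longrightarrow> ell_vol E \<le> ell_vol F))"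

definition MaxIE :: "(real^'n) set \<Rightarrow> (real^'n) set" where
  "MaxIE P = (THE E. is_ellipsoid E \<and> E \<subseteq> P \<and>
     (\<forall>F. is_ellipsoid F \<and> F \<subseteq> P \<longrightarrow> ell_vol F \<le> ell_vol E))"

definition log_vol_polar :: "(real^'n) set \<Rightarrow> real^'n \<Rightarrow> real" where
  "log_vol_polar P x = ln (ell_vol (MinCE (polar ((\<lambda>p. p - x) ` P))))"

lemma ellipsoid_subset_imp_quad_le:
  fixes Q R :: "real^'n^'n"
  assumes Q: "sym_pos_def Q" and sub: "ellipsoid c Q \<subseteq> ellipsoid c R"
  shows "z \<bullet> (R *v z) \<le> z \<bullet> (Q *v z)"
proof (cases "z = 0")
  case False
  define q where "q = z \<bullet> (Q *v z)"
  have q: "q > 0" using Q False by (simp add: sym_pos_def_def q_def)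
  define t where "t = 1 / sqrt q"
  have t2: "t * t * q = 1" using q by (simp add: t_def)
  have "c + t *\<^sub>R z \<in> ellipsoid c Q"
    using t2 by (simp add: ellipsoid_def matrix_vector_mult_scaleR q_def mult.assoc)
  then have "c + t *\<^sub>R z \<in> ellipsoid c R" using sub by blast
  then have "(t * t) * (z \<bullet> (R *v z)) \<le> (t * t) * q"
    using t2 by (simp add: ellipsoid_def matrix_vector_mult_scaleR mult.assoc)
  moreover have "t * t > 0" using q by (simp add: t_def)
  ultimately have "z \<bullet> (R *v z) \<le> q" by (rule mult_left_le_imp_le)
  then show ?thesis by (simp add: q_def)
qed simp

lemma symmetric_quad_eq_imp_eq:
  fixes Q R :: "real^'n^'n"
  assumes "transpose Q = Q" "transpose R = R"
    and eq: "\<And>z. z \<bullet> (Q *v z) = z \<bullet> (R *v z)"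
  shows "Q = R"
proof -
  have sym: "y \<bullet> (A *v x) = x \<bullet> (A *v y)" if "transpose A = A" for A :: "real^'n^'n" and x y
    by (metis dot_lmul_matrix inner_commute that vector_transpose_matrix)
  have "x \<bullet> (Q *v y) = x \<bullet> (R *v y)" for x y
    using eq[of "x + y"] eq[of x] eq[of y] sym[OF assms(1), of y x] sym[OF assms(2), of y x]
    by (simp add: matrix_vector_right_distrib inner_add_left inner_add_right)
  then have "Q *v y = R *v y" for y
    by (metis vector_eq_rdot inner_commute)
  then show ?thesis by (simp add: matrix_eq)
qed

lemma ellipsoid_eq_imp_center_eq:
  fixes Q R :: "real^'n^'n"
  assumes Q: "sym_pos_def Q" and eq: "ellipsoid c Q = ellipsoid d R"
  shows "c = d"
proof (rule ccontr)
  assume "c \<noteq> d"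
  define w where "w = 2 *\<^sub>R (d - c)"
  have "w \<noteq> 0" using \<open>c \<noteq> d\<close> by (simp add: w_def)
  then have w: "w \<bullet> (Q *v w) > 0" using Q by (simp add: sym_pos_def_def)
  have refl: "2 *\<^sub>R b - y \<in> ellipsoid b A" if "y \<in> ellipsoid b A"
    for y b :: "real^'n" and A
  proof -
    have "2 *\<^sub>R b - y - b = (-1) *\<^sub>R (y - b)" by (simp add: scaleR_2)
    moreover have "((-1) *\<^sub>R u) \<bullet> (A *v ((-1) *\<^sub>R u)) = u \<bullet> (A *v u)" for u
      unfolding matrix_vector_mult_scaleR by simp
    ultimately show ?thesis using that unfolding ellipsoid_def mem_Collect_eq by metis
  qed
  have shift: "y + w \<in> ellipsoid c Q" if "y \<in> ellipsoid c Q" for y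
  proof -
    have "2 *\<^sub>R d - (2 *\<^sub>R c - y) \<in> ellipsoid c Q" using refl that eq by metis
    moreover have "2 *\<^sub>R d - (2 *\<^sub>R c - y) = y + w" by (simp add: w_def algebra_simps)
    ultimately show ?thesis by simp
  qed
  have in_all: "c + real k *\<^sub>R w \<in> ellipsoid c Q" for k
  proof (induction k)
    case 0
    show ?case by (simp add: ellipsoid_def)
  next
    case (Suc k)
    then show ?case using shift[of "c + real k *\<^sub>R w"] by (simp add: algebra_simps)
  qed
  obtain k :: nat where k: "1 / (w \<bullet> (Q *v w)) < real k" using reals_Archimedean2 by blast
  have k1: "k > 0" using k w by (cases k) (auto simp: field_simps)
  have "real k * (real k * (w \<bullet> (Q *v w))) \<le> 1"
    using in_all[of k] by (simp add: ellipsoid_def matrix_vector_mult_scaleR)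
  moreover have "1 < real k * (w \<bullet> (Q *v w))" using k w by (simp add: field_simps)
  moreover have "real k * (w \<bullet> (Q *v w)) \<le> real k * (real k * (w \<bullet> (Q *v w)))"
    using k1 w mult_right_mono[of 1 "real k" "real k * (w \<bullet> (Q *v w))"] by simp
  ultimately show False by linarith
qed

lemma ellipsoid_eq_iff:
  fixes Q R :: "real^'n^'n"
  assumes Q: "sym_pos_def Q" and R: "sym_pos_def R"
  shows "ellipsoid c Q = ellipsoid d R \<longleftrightarrow> c = d \<and> Q = R"
proof
  assume eq: "ellipsoid c Q = ellipsoid d R"
  have cd: "c = d" using ellipsoid_eq_imp_center_eq[OF Q eq] .
  have "z \<bullet> (Q *v z) = z \<bullet> (R *v z)" for z
    using ellipsoid_subset_imp_quad_le[OF Q, of c R z] ellipsoid_subset_imp_quad_le[OF R, of c Q z]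
      eq cd by auto
  then have "Q = R" using symmetric_quad_eq_imp_eq Q R by (metis sym_pos_def_def)
  with cd show "c = d \<and> Q = R" by simp
qed simp

lemma ell_center_ellipsoid: "sym_pos_def Q \<Longrightarrow> ell_center (ellipsoid c Q) = c"
  unfolding ell_center_def by (rule the_equality) (auto simp: ellipsoid_eq_iff)

lemma ell_vol_ellipsoid: "sym_pos_def Q \<Longrightarrow> ell_vol (ellipsoid c Q) = det Q powr (-1/2)"
  unfolding ell_vol_def by (rule the_equality) (auto simp: ellipsoid_eq_iff)

end

theory Submission
  imports Defs
begin

text \<open>
  Polarity turns an ellipsoid with shape matrix \<open>Q\<close> around \<open>(P - x)\<^sup>\<circ>\<close> into an ellipsoid in \<open>P\<close>
  with center \<open>c\<close> and shape matrix \<open>S\<close>, where \<open>det Q \<le> det S * (1 - |c - x|\<^sup>2 / \<rho>\<^sup>2)\<close> if \<open>P\<close> lies in the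
  ball of radius \<open>\<rho>\<close>. So moving \<open>x\<close> away from \<open>c\<close> costs volume quadratically, and it remains to
  show that the volume of an inscribed ellipsoid decays quadratically in the distance between its
  center and \<open>x\<^sup>*\<close>. For this, two inscribed ellipsoids \<open>(c\<^sub>1, S\<^sub>1)\<close>, \<open>(c\<^sub>2, S\<^sub>2)\<close> are interpolated: if \<open>G\<close>
  is the geometric mean of \<open>S\<^sub>1\<close> and \<open>S\<^sub>2\<close>, then the ellipsoid centered at \<open>(c\<^sub>1 + c\<^sub>2) / 2\<close> with shape
  \<open>G + z z\<^sup>T / 8\<close>, \<open>z = c\<^sub>1 - c\<^sub>2\<close>, is again inscribed, and the rank-one term enlarges its determinant by
  a factor \<open>1 + |z|\<^sup>2 / (8 \<rho>\<^sup>2)\<close> at least; maximality of \<open>(c\<^sub>1, S\<^sub>1)\<close> gives the claim. The same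
  interpolation shows that the center of the maximal ellipsoid is unique.
\<close>

subsection \<open>Symmetric matrices\<close>

declare transpose_matrix_vector [simp del] vector_transpose_matrix [simp del]

lemma inner_matrix_vector_transpose:
  fixes A :: "real^'n^'m"
  shows "x \<bullet> (A *v y) = (transpose A *v x) \<bullet> y"
  by (metis dot_lmul_matrix transpose_matrix_vector)

lemma symmetric_inner:
  fixes A :: "real^'n^'n"
  assumes "transpose A = A"
  shows "x \<bullet> (A *v y) = y \<bullet> (A *v x)"
  by (metis assms inner_commute inner_matrix_vector_transpose)

section \<open>Spectral theorem for real symmetric matrices\<close>

lemma quadratic_nonneg_imp_linear_zero:
  fixes b c :: real
  assumes "\<And>t. 0 \<le> b * t + c * t\<^sup>2"
  shows "b = 0"
proof (rule ccontr)
  assume "b \<noteq> 0"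
  \<comment> \<open>Since \<open>k\<close> exceeds both 0 and \<open>c\<close>, the point
    \<open>- b / k\<close> is so close to 0 that the linear term outweighs the quadratic
    one.\<close>
  define k where "k = \<bar>c\<bar> + 1"
  have k: "k > 0" "c < k" by (auto simp: k_def)
  have "0 \<le> b * (- b / k) + c * (- b / k)\<^sup>2" by (rule assms)
  also have "\<dots> = (b\<^sup>2 / k) * (c / k - 1)"
    using k by (simp add: power2_eq_square field_simps)
  also have "\<dots> < 0"
    using k \<open>b \<noteq> 0\<close> by (intro mult_pos_neg) (auto simp: field_simps)
  finally show False by simp
qed

text \<open>A maximizer \<open>x\<close> of the quadratic form on the unit sphere of
  \<open>W\<close> is critical: along \<open>x + t *\<^sub>R y\<close> with \<open>y\<close> in
  \<open>W\<close>, the inequality \<open>ray\<close> is an equality at \<open>t = 0\<close>, so its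
  first-order term vanishes. Hence the residual \<open>A *v x - l *\<^sub>R x\<close> is orthogonal
  to \<open>W\<close>; by invariance it also lies in \<open>W\<close>, so it is zero.\<close>

lemma symmetric_eigenvector_in_subspace:
  fixes A :: "real^'n^'n"
  assumes sym: "transpose A = A" and W: "subspace W" and inv: "\<And>w. w \<in> W \<Longrightarrow> A *v w \<in> W"
    and ne: "W \<noteq> {0}"
  shows "\<exists>x\<in>W. \<exists>l. norm x = 1 \<and> A *v x = l *\<^sub>R x"
proof -
  let ?q = "\<lambda>x. x \<bullet> (A *v x)"
  obtain w where w: "w \<in> W" "w \<noteq> 0" using ne subspace_0[OF W] by blast
  have "compact (W \<inter> sphere 0 1)"
    using closed_subspace[OF W] by (simp add: closed_Int_compact)
  moreover have "(1 / norm w) *\<^sub>R w \<in> W \<inter> sphere 0 1"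
    using w W by (simp add: subspace_scale)
  moreover have "continuous_on (W \<inter> sphere 0 1) ?q"
    by (intro continuous_intros linear_continuous_on linear_linear[THEN iffD2]
        matrix_vector_mul_linear)
  ultimately obtain x where x: "x \<in> W" "norm x = 1"
    and max: "\<And>y. y \<in> W \<Longrightarrow> norm y = 1 \<Longrightarrow> ?q y \<le> ?q x"
    using continuous_attains_sup[of "W \<inter> sphere 0 1" ?q] by force
  define l where "l = ?q x"
  have ray: "?q y \<le> l * (y \<bullet> y)" if "y \<in> W" for y
  proof (cases "y = 0")
    case False
    have "?q ((1 / norm y) *\<^sub>R y) \<le> l"
      unfolding l_def using False that W by (intro max) (auto simp: subspace_scale)
    then have "?q y / (norm y)\<^sup>2 \<le> l"
      by (simp add: matrix_vector_mult_scaleR power2_eq_square)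
    then show ?thesis using False by (simp add: divide_le_eq dot_square_norm)
  qed simp
  have orth: "(A *v x - l *\<^sub>R x) \<bullet> y = 0" if y: "y \<in> W" for y
  proof -
    have "0 \<le> (- 2 * ((A *v x - l *\<^sub>R x) \<bullet> y)) * t + (l * (y \<bullet> y) - ?q y) * t\<^sup>2" for t
    proof -
      have 1: "?q (x + t *\<^sub>R y) \<le> l * ((x + t *\<^sub>R y) \<bullet> (x + t *\<^sub>R y))"
        using x y W by (intro ray) (simp add: subspace_add subspace_scale)
      have 2: "?q (x + t *\<^sub>R y) = l + 2 * t * ((A *v x) \<bullet> y) + t\<^sup>2 * ?q y"
        using symmetric_inner[OF sym, of x y]
        by (simp add: matrix_vector_right_distrib matrix_vector_mult_scaleR inner_add_left
            inner_add_right l_def power2_eq_square algebra_simps inner_commute)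
      have 3: "(x + t *\<^sub>R y) \<bullet> (x + t *\<^sub>R y) = 1 + 2 * t * (x \<bullet> y) + t\<^sup>2 * (y \<bullet> y)"
        using x by (simp add: inner_add_left inner_add_right norm_eq_1 power2_eq_square
            inner_commute algebra_simps)
      from 1[unfolded 2 3] show ?thesis
        by (simp add: inner_diff_left algebra_simps)
    qed
    from quadratic_nonneg_imp_linear_zero[OF this] show ?thesis by simp
  qed
  have "A *v x - l *\<^sub>R x \<in> W"
    using x inv W by (simp add: subspace_diff subspace_scale)
  from orth[OF this] have "A *v x = l *\<^sub>R x" by simp
  with x show ?thesis by blast
qed

definition diag :: "('n \<Rightarrow> real) \<Rightarrow> real^'n^'n" where
  "diag d = (\<chi> i j. if i = j then d i else 0)"

lemma transpose_diag [simp]: "transpose (diag d) = diag d"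
  by (simp add: diag_def transpose_def vec_eq_iff)

lemma diag_mult_vec [simp]: "diag d *v x = (\<chi> i. d i * x $ i)"
  by (simp add: diag_def matrix_vector_mult_def vec_eq_iff if_distrib[of "\<lambda>z. z * _"] cong: if_cong)

lemma diag_mult: "diag d ** diag e = diag (\<lambda>i. d i * e i)"
  by (simp add: matrix_eq matrix_vector_mul_assoc[symmetric] vec_eq_iff mult.assoc)

lemma det_diag [simp]: "det (diag d) = (\<Prod>i\<in>UNIV. d i)"
  by (subst det_diagonal) (auto simp: diag_def)

lemma diag_one: "diag (\<lambda>i. 1) = mat 1"
  by (simp add: diag_def mat_def)

text \<open>An orthonormal set of eigenvectors of maximal cardinality spans the space: its
  orthogonal complement is invariant under \<open>A\<close>, so a nonzero complement would supply
  one more eigenvector.\<close>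

theorem symmetric_diagonalization:
  fixes A :: "real^'n^'n"
  assumes sym: "transpose A = A"
  shows "\<exists>U d. orthogonal_matrix U \<and> A = U ** diag d ** transpose U"
proof -
  define good where "good B \<longleftrightarrow> pairwise orthogonal B \<and>
    (\<forall>x\<in>B. norm x = 1 \<and> (\<exists>l. A *v x = l *\<^sub>R x))" for B :: "(real^'n) set"
  have indep: "independent B" if "good B" for B
    using that by (intro pairwise_orthogonal_independent) (auto simp: good_def)
  have bound: "card B \<le> CARD('n)" if "good B" for B
    using independent_bound_general[OF indep[OF that]] dim_subset_UNIV_cart[of B] by linarith
  have "good {}" by (simp add: good_def)
  moreover have "\<forall>B. good B \<longrightarrow> card B < Suc CARD('n)" using bound by (simp add: less_Suc_eq_le)
  ultimately obtain B where B: "good B" and max: "\<And>C. good C \<Longrightarrow> card C \<le> card B"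
    using ex_has_greatest_nat[of good "{}" card "Suc CARD('n)"] by blast
  have finB: "finite B" using indep[OF B] independent_imp_finite by blast
  define W where "W = {w. \<forall>b\<in>B. orthogonal b w}"
  have W: "subspace W" unfolding W_def by (rule subspace_orthogonal_to_vectors)
  have "W = {0}"
  proof (rule ccontr)
    assume ne: "W \<noteq> {0}"
    have inv: "A *v w \<in> W" if "w \<in> W" for w
      unfolding W_def orthogonal_def mem_Collect_eq
    proof
      fix b assume "b \<in> B"
      then obtain l where "A *v b = l *\<^sub>R b" using B by (auto simp: good_def)
      then have "b \<bullet> (A *v w) = l * (b \<bullet> w)"
        by (simp add: symmetric_inner[OF sym, of b w] inner_commute)
      then show "b \<bullet> (A *v w) = 0" using that \<open>b \<in> B\<close> by (auto simp: W_def orthogonal_def)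
    qed
    obtain x l where x: "x \<in> W" "norm x = 1" "A *v x = l *\<^sub>R x"
      using symmetric_eigenvector_in_subspace[OF sym W inv ne] by blast
    have "x \<notin> B" using x by (auto simp: W_def orthogonal_def norm_eq_1)
    moreover have "good (insert x B)"
      using B x by (auto simp: good_def pairwise_insert W_def orthogonal_commute)
    ultimately show False using max[of "insert x B"] finB by simp
  qed
  then have "span B = UNIV"
  proof -
    have "\<not> dim B < DIM(real^'n)"
    proof
      assume "dim B < DIM(real^'n)"
      then obtain x where "x \<noteq> 0" "\<And>y. y \<in> span B \<Longrightarrow> orthogonal x y"
        using orthogonal_to_subspace_exists by blast
      then have "x \<in> W" unfolding W_def by (auto simp: orthogonal_commute span_base)
      with \<open>W = {0}\<close> \<open>x \<noteq> 0\<close> show False by simp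
    qed
    then show ?thesis using dim_eq_full[of B] dim_subset_UNIV[of B] by linarith
  qed
  then have "card B = CARD('n)"
    using dim_eq_card_independent[OF indep[OF B]] dim_eq_full[of B] by simp
  then obtain f where f: "bij_betw f (UNIV :: 'n set) B"
    using finB by (metis finite_same_card_bij finite_class.finite_UNIV)
  define U :: "real^'n^'n" where "U = transpose (\<chi> i. f i)"
  have colU: "column i U = f i" for i by (simp add: U_def row_def)
  have fB: "f i \<in> B" for i using f by (auto simp: bij_betw_def)
  have "\<forall>i. \<exists>l. A *v f i = l *\<^sub>R f i" using B fB unfolding good_def by blast
  from choice[OF this] obtain d where d: "A *v f i = d i *\<^sub>R f i" for i by blast
  have orthU: "orthogonal_matrix U"
    unfolding orthogonal_matrix_orthonormal_columns colU
  proof (intro conjI allI impI)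
    show "norm (f i) = 1" for i using B fB[of i] unfolding good_def by blast
    fix i j :: 'n assume "i \<noteq> j"
    then have "f i \<noteq> f j" using bij_betw_imp_inj_on[OF f] by (auto dest: injD)
    moreover have "pairwise orthogonal B" using B unfolding good_def by blast
    ultimately show "orthogonal (f i) (f j)" using fB by (simp add: pairwise_def)
  qed
  have "A ** U = U ** diag d"
  proof -
    have "(A ** U) *v axis i 1 = (U ** diag d) *v axis i 1" for i
    proof -
      have "(A ** U) *v axis i 1 = d i *\<^sub>R f i"
        unfolding matrix_vector_mul_assoc[symmetric] matrix_vector_mult_basis[of U] colU d ..
      moreover have "diag d *v axis i 1 = d i *\<^sub>R axis i 1"
        by (simp add: vec_eq_iff axis_def)
      then have "(U ** diag d) *v axis i 1 = d i *\<^sub>R f i"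
        by (simp only: matrix_vector_mul_assoc[symmetric] matrix_vector_mult_scaleR
            matrix_vector_mult_basis[of U] colU)
      ultimately show ?thesis by simp
    qed
    then have "column i (A ** U) = column i (U ** diag d)" for i
      by (simp only: matrix_vector_mult_basis)
    then show ?thesis by (simp add: vec_eq_iff column_def)
  qed
  then have "A = U ** diag d ** transpose U"
    using orthU by (metis matrix_mul_assoc matrix_mul_rid orthogonal_matrix_def)
  with orthU show ?thesis by blast
qed

section \<open>Positive definite matrices: congruence, factorization, simultaneous
  diagonalization\<close>

lemma scaleR_matrix_vector: "(k *\<^sub>R A) *v x = k *\<^sub>R (A *v x)"
  for A :: "real^'n^'m"
  by (simp add: scaleR_matrix_vector_assoc)

lemma det_scaleR: "det (k *\<^sub>R A) = k ^ CARD('n) * det (A :: real^'n^'n)"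
proof -
  have "k *\<^sub>R A = diag (\<lambda>_. k) ** A"
    by (simp add: matrix_eq matrix_vector_mul_assoc[symmetric] scaleR_matrix_vector vec_eq_iff)
  then show ?thesis by (simp add: det_mul)
qed

lemma sym_pos_def_nonneg: "sym_pos_def S \<Longrightarrow> 0 \<le> x \<bullet> (S *v x)"
  by (cases "x = 0") (simp_all add: sym_pos_def_def less_imp_le)

lemma sym_pos_def_congruence:
  fixes M A :: "real^'n^'n"
  assumes "invertible M" "sym_pos_def A"
  shows "sym_pos_def (transpose M ** A ** M)"
proof -
  have "M *v x \<noteq> 0" if "x \<noteq> 0" for x
    using assms(1) that by (metis invertible_def matrix_vector_mul_assoc matrix_vector_mul_lid
        matrix_vector_mult_0_right)
  then show ?thesis using assms(2)
    by (simp add: sym_pos_def_def matrix_transpose_mul matrix_mul_assoc matrix_vector_mul_assoc[symmetric]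
        inner_matrix_vector_transpose[of _ "transpose M"])
qed

lemma sym_pos_def_diag: "(\<And>i. d i > 0) \<Longrightarrow> sym_pos_def (diag d)"
proof -
  assume d: "\<And>i. d i > 0"
  have "0 < x \<bullet> (diag d *v x)" if "x \<noteq> 0" for x
  proof -
    obtain k where "x $ k \<noteq> 0" using \<open>x \<noteq> 0\<close> by (auto simp: vec_eq_iff)
    then have "0 < (\<Sum>i\<in>UNIV. d i * (x $ i)\<^sup>2)"
      using d by (intro sum_pos2[of _ k]) (auto simp: less_imp_le)
    then show ?thesis by (simp add: inner_vec_def power2_eq_square algebra_simps)
  qed
  then show ?thesis by (simp add: sym_pos_def_def)
qed

lemma sym_pos_def_one: "sym_pos_def (mat 1)"
  using sym_pos_def_diag[of "\<lambda>i. 1"] by (simp add: diag_one)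

lemma sym_pos_def_gram:
  fixes N :: "real^'n^'n"
  shows "invertible N \<Longrightarrow> sym_pos_def (transpose N ** N)"
  using sym_pos_def_congruence[OF _ sym_pos_def_one] by simp

lemma sym_pos_def_diagonalization:
  fixes A :: "real^'n^'n"
  assumes "sym_pos_def A"
  shows "\<exists>U d. orthogonal_matrix U \<and> A = U ** diag d ** transpose U \<and> (\<forall>i. d i > 0)"
proof -
  obtain U d where U: "orthogonal_matrix U" and A: "A = U ** diag d ** transpose U"
    using symmetric_diagonalization assms unfolding sym_pos_def_def by blast
  have "d i > 0" for i
  proof -
    have "transpose U *v (U *v axis i 1) = axis i 1"
      using U by (simp add: matrix_vector_mul_assoc orthogonal_matrix_def)
    moreover from this have "U *v axis i 1 \<noteq> 0" by (metis axis_eq_0_iff matrix_vector_mult_0_right zero_neq_one)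
    ultimately have "0 < axis i 1 \<bullet> (diag d *v axis i 1)"
      using assms unfolding A sym_pos_def_def
      by (metis inner_matrix_vector_transpose matrix_vector_mul_assoc)
    then show ?thesis by (simp add: inner_axis')
  qed
  with U A show ?thesis by blast
qed

lemma sym_pos_def_factor:
  fixes A :: "real^'n^'n"
  assumes "sym_pos_def A"
  obtains L :: "real^'n^'n" where "invertible L" "A = L ** transpose L"
proof -
  obtain U d where U: "orthogonal_matrix U" and A: "A = U ** diag d ** transpose U"
    and d: "\<And>i. d i > 0"
    using sym_pos_def_diagonalization[OF assms] by blast
  define L where "L = U ** diag (\<lambda>i. sqrt (d i))"
  have "A = L ** transpose L"
    using d by (simp add: A L_def matrix_transpose_mul less_imp_le diag_mult
        matrix_mul_assoc[of U "diag _", symmetric] matrix_mul_assoc[of U _ "transpose U", symmetric]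
        matrix_mul_assoc[of "diag _" "diag _"])
  moreover have "det L \<noteq> 0"
    using det_orthogonal_matrix[OF U] d by (auto simp: L_def det_mul less_imp_neq[symmetric])
  ultimately show ?thesis using that[of L] by (simp add: invertible_det_nz)
qed

lemma sym_pos_def_det_pos: "sym_pos_def (A :: real^'n^'n) \<Longrightarrow> det A > 0"
  by (erule sym_pos_def_factor) (simp add: det_mul invertible_det_nz zero_less_mult_iff less_le)

text \<open>With \<open>A = L ** transpose L\<close> and \<open>K\<close> the inverse of
  \<open>L\<close>, the matrix \<open>K ** B ** transpose K\<close> is positive definite and has an
  orthogonal eigenbasis \<open>U\<close>. Then \<open>M = L ** U\<close> carries the identity to
  \<open>A\<close> and the diagonal of eigenvalues to \<open>B\<close>.\<close>

lemma simultaneous_diagonalization: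
  fixes A B :: "real^'n^'n"
  assumes A: "sym_pos_def A" and B: "sym_pos_def B"
  shows "\<exists>(M :: real^'n^'n) d. invertible M \<and> (\<forall>i. d i > 0) \<and> A = M ** transpose M \<and>
    B = M ** diag d ** transpose M"
proof -
  obtain L :: "real^'n^'n" where L: "invertible L" "A = L ** transpose L"
    by (rule sym_pos_def_factor[OF A])
  then obtain K :: "real^'n^'n" where K: "L ** K = mat 1" "K ** L = mat 1" unfolding invertible_def by blast
  have Kt: "transpose K ** transpose L = mat 1"
    by (metis K(1) matrix_transpose_mul transpose_mat)
  have "invertible (transpose K)" using K transpose_invertible invertible_def by blast
  then have "sym_pos_def (K ** B ** transpose K)"
    using sym_pos_def_congruence[OF _ B, of "transpose K"] by simp
  then obtain U d where U: "orthogonal_matrix U" and C: "K ** B ** transpose K = U ** diag d ** transpose U"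
    and d: "\<And>i. d i > 0"
    using sym_pos_def_diagonalization by blast
  define M where "M = L ** U"
  have "A = M ** transpose M"
    using U by (simp add: L M_def matrix_transpose_mul orthogonal_matrix_def
        matrix_mul_assoc[of L U, symmetric] matrix_mul_assoc[of U "transpose U"])
  moreover have "B = M ** diag d ** transpose M"
  proof -
    have "M ** diag d ** transpose M = L ** (U ** diag d ** transpose U) ** transpose L"
      by (simp add: M_def matrix_transpose_mul matrix_mul_assoc)
    also have "\<dots> = (L ** K) ** B ** (transpose K ** transpose L)"
      by (simp add: C[symmetric] matrix_mul_assoc)
    also have "\<dots> = B" by (simp add: K Kt)
    finally show ?thesis by simp
  qed
  moreover have "invertible M"
    using L U unfolding M_def by (metis invertible_mult invertible_def orthogonal_matrix_def)
  ultimately show ?thesis using d by blast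
qed

section \<open>Rank-one terms \<open>z z^T\<close> and their effect on determinants\<close>

definition outer :: "real^'n \<Rightarrow> real^'n^'n" where
  "outer z = (\<chi> i j. z $ i * z $ j)"

lemma outer_mult_vec [simp]: "outer z *v x = (z \<bullet> x) *\<^sub>R z"
  by (simp add: outer_def matrix_vector_mult_def vec_eq_iff inner_vec_def sum_distrib_left
      sum_distrib_right mult_ac)

lemma transpose_outer [simp]: "transpose (outer z) = outer z"
  by (simp add: outer_def transpose_def vec_eq_iff mult.commute)

lemma outer_congruence: "M ** outer v ** transpose M = outer (M *v v)"
  by (simp add: matrix_eq matrix_vector_mul_assoc[symmetric] matrix_vector_mult_scaleR
      inner_matrix_vector_transpose[of _ M] inner_commute)

lemma transpose_add: "transpose (A + B) = transpose A + transpose B"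
  by (simp add: transpose_def vec_eq_iff)

lemma sym_pos_def_add_outer:
  assumes "sym_pos_def G"
  shows "sym_pos_def (G + outer z)"
  using assms by (simp add: sym_pos_def_def transpose_add matrix_vector_mult_add_rdistrib
      inner_add_right add_pos_nonneg inner_commute[of z])

lemma congruence_add:
  fixes M A B :: "real^'n^'n"
  shows "M ** (A + B) ** transpose M = M ** A ** transpose M + M ** B ** transpose M"
  by (simp add: matrix_eq matrix_vector_mul_assoc[symmetric] matrix_vector_mult_add_rdistrib
      matrix_vector_right_distrib)

lemma det_congruence: "det (M ** A ** transpose M) = (det M)\<^sup>2 * det (A :: real^'n^'n)"
  by (simp add: det_mul power2_eq_square)

text \<open>A rotation takes a coordinate axis to the direction of \<open>w\<close>; in that frame
  the matrix is diagonal with one entry \<open>1 + w \<bullet> w\<close> and ones elsewhere.\<close>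

lemma det_one_add_outer:
  fixes w :: "real^'n"
  shows "det (mat 1 + outer w) = 1 + w \<bullet> w"
proof (cases "w = 0")
  case True
  then have "outer w = 0" by (simp add: outer_def vec_eq_iff)
  then show ?thesis using True by simp
next
  case False
  obtain k :: 'n where True by blast
  obtain R where R: "orthogonal_matrix R" "R *v axis k 1 = (1 / norm w) *\<^sub>R w"
    using orthogonal_matrix_exists_basis[of "(1 / norm w) *\<^sub>R w" k] False by auto
  have w: "w = R *v axis k (norm w)"
  proof -
    have "axis k (norm w) = norm w *\<^sub>R axis k 1" by (simp add: axis_def vec_eq_iff)
    then show ?thesis using R(2) False by (simp add: matrix_vector_mult_scaleR)
  qed
  define e where "e = (\<lambda>i. if i = k then 1 + w \<bullet> w else 1)"
  have "mat 1 + outer (axis k (norm w)) = diag e"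
    by (auto simp: mat_def outer_def axis_def diag_def e_def vec_eq_iff dot_square_norm power2_eq_square)
  then have "mat 1 + outer w = R ** diag e ** transpose R"
    using R(1) congruence_add[of R "mat 1" "outer (axis k (norm w))"]
    by (simp add: outer_congruence w[symmetric] orthogonal_matrix_def)
  moreover have "(det R)\<^sup>2 = 1" using det_orthogonal_matrix[OF R(1)] by auto
  ultimately show ?thesis by (simp add: det_congruence e_def)
qed

text \<open>For \<open>G = L ** transpose L\<close> and \<open>z = L *v w\<close> the determinant
  grows exactly by the factor \<open>1 + w \<bullet> w\<close>, where \<open>w \<bullet> w\<close>
  is the value at \<open>z\<close> of the form of the inverse of \<open>G\<close>. By
  Cauchy-Schwarz, (z, z)^2 is at most (z, G z) (w, w), so an upper bound on the form of
  \<open>G\<close> at \<open>z\<close> bounds \<open>w \<bullet> w\<close> from below.\<close>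

lemma det_add_outer_ge:
  fixes G :: "real^'n^'n"
  assumes G: "sym_pos_def G" and r: "r > 0" "z \<bullet> (G *v z) \<le> r * (z \<bullet> z)"
  shows "det (G + outer z) \<ge> det G * (1 + (z \<bullet> z) / r)"
proof -
  obtain L :: "real^'n^'n" where L: "invertible L" "G = L ** transpose L" by (rule sym_pos_def_factor[OF G])
  then obtain K :: "real^'n^'n" where K: "L ** K = mat 1" unfolding invertible_def by blast
  define w where "w = K *v z"
  have z: "z = L *v w" by (simp add: w_def matrix_vector_mul_assoc K)
  have "G + outer z = L ** (mat 1 + outer w) ** transpose L"
    by (simp add: congruence_add outer_congruence z L)
  then have det: "det (G + outer z) = det G * (1 + w \<bullet> w)"
    by (simp add: det_congruence det_one_add_outer L det_mul power2_eq_square)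
  have "(z \<bullet> z)\<^sup>2 = ((transpose L *v z) \<bullet> w)\<^sup>2"
    by (metis inner_matrix_vector_transpose z)
  also have "\<dots> \<le> ((transpose L *v z) \<bullet> (transpose L *v z)) * (w \<bullet> w)"
    by (rule Cauchy_Schwarz_ineq)
  also have "(transpose L *v z) \<bullet> (transpose L *v z) = z \<bullet> (G *v z)"
    by (simp add: L matrix_vector_mul_assoc[symmetric] inner_matrix_vector_transpose[of z L])
  also have "\<dots> * (w \<bullet> w) \<le> r * (z \<bullet> z) * (w \<bullet> w)"
    using r by (intro mult_right_mono) auto
  finally have *: "(z \<bullet> z) * (z \<bullet> z) \<le> (z \<bullet> z) * (r * (w \<bullet> w))"
    by (simp add: power2_eq_square mult_ac)
  have "z \<bullet> z \<le> r * (w \<bullet> w)"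
  proof (cases "z = 0")
    case False
    then show ?thesis using * by (simp add: mult_le_cancel_left_pos)
  qed (use r in simp)
  then show ?thesis
    using r sym_pos_def_det_pos[OF G] by (simp add: det divide_le_eq mult.commute)
qed

section \<open>Geometric and arithmetic means of positive definite matrices\<close>

text \<open>In a frame where \<open>A\<close> is the identity and \<open>B\<close> is
  \<open>diag d\<close>, take \<open>G\<close> to be the diagonal of the square roots of
  \<open>d\<close>. The bound on its form is Cauchy-Schwarz for \<open>p\<close> and
  \<open>diag h *v p\<close>.\<close>

lemma sym_pos_def_geometric_mean:
  fixes A B :: "real^'n^'n"
  assumes A: "sym_pos_def A" and B: "sym_pos_def B"
  obtains G where "sym_pos_def G" "(det G)\<^sup>2 = det A * det B"
    "\<And>u. u \<bullet> (G *v u) \<le> sqrt (u \<bullet> (A *v u)) * sqrt (u \<bullet> (B *v u))"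
proof -
  obtain M :: "real^'n^'n" and d where M: "invertible M" and d: "\<And>i. d i > 0" and A': "A = M ** transpose M"
    and B': "B = M ** diag d ** transpose M"
    using simultaneous_diagonalization[OF A B] by blast
  define h where "h = (\<lambda>i. sqrt (d i))"
  have h: "h i > 0" "h i * h i = d i" for i using d[of i] by (auto simp: h_def)
  define G where "G = M ** diag h ** transpose M"
  have "sym_pos_def G"
    using sym_pos_def_congruence[of "transpose M" "diag h"] M h
    by (simp add: G_def sym_pos_def_diag transpose_invertible)
  moreover have "(det G)\<^sup>2 = det A * det B"
    using h by (simp add: G_def A' B' det_congruence det_mul power2_eq_square prod.distrib[symmetric])
  moreover have "u \<bullet> (G *v u) \<le> sqrt (u \<bullet> (A *v u)) * sqrt (u \<bullet> (B *v u))" for u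
  proof -
    define p where "p = transpose M *v u"
    have A1: "u \<bullet> (A *v u) = p \<bullet> p"
      by (simp add: A' p_def matrix_vector_mul_assoc[symmetric] inner_matrix_vector_transpose[of u M])
    have B1: "u \<bullet> (B *v u) = (diag h *v p) \<bullet> (diag h *v p)"
    proof -
      have "u \<bullet> (B *v u) = p \<bullet> (diag d *v p)"
        by (simp add: B' p_def matrix_vector_mul_assoc[symmetric] inner_matrix_vector_transpose[of u M]
            del: diag_mult_vec)
      then show ?thesis by (simp add: inner_vec_def h(2)[symmetric] mult_ac)
    qed
    have "u \<bullet> (G *v u) = p \<bullet> (diag h *v p)"
      by (simp add: G_def p_def matrix_vector_mul_assoc[symmetric] inner_matrix_vector_transpose[of u M]
            del: diag_mult_vec)
    then show ?thesis
      unfolding A1 B1 norm_eq_sqrt_inner[symmetric] by (simp add: norm_cauchy_schwarz)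
  qed
  ultimately show ?thesis using that by blast
qed

lemma sym_pos_def_midpoint:
  fixes A B :: "real^'n^'n"
  assumes "sym_pos_def A" "sym_pos_def B"
  shows "sym_pos_def ((1/2) *\<^sub>R (A + B))"
  using assms by (simp add: sym_pos_def_def transpose_scalar transpose_add scaleR_matrix_vector
      matrix_vector_mult_add_rdistrib inner_add_right add_pos_pos)

text \<open>After simultaneous diagonalization, equal determinants mean that the \<open>d i\<close>
  have product 1. The means \<open>(1 + d i) / 2\<close> dominate the roots
  \<open>sqrt (d i)\<close>, whose product is also 1, and strictly so at some \<open>k\<close>,
  since \<open>A \<noteq> B\<close> excludes that all \<open>d i\<close> are 1.\<close>

lemma det_midpoint_strict:
  fixes A B :: "real^'n^'n"
  assumes A: "sym_pos_def A" and B: "sym_pos_def B" and eq: "det A = det B" and ne: "A \<noteq> B"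
  shows "det A < det ((1/2) *\<^sub>R (A + B))"
proof -
  obtain M :: "real^'n^'n" and d where M: "invertible M" and d: "\<And>i. d i > 0" and A': "A = M ** transpose M"
    and B': "B = M ** diag d ** transpose M"
    using simultaneous_diagonalization[OF A B] by blast
  have dM: "(det M)\<^sup>2 > 0" using M by (simp add: invertible_det_nz)
  have "(det M)\<^sup>2 * (\<Prod>i\<in>UNIV. d i) = (det M)\<^sup>2"
    using eq by (simp add: A' B' det_congruence) (simp add: det_mul power2_eq_square)
  then have prod1: "(\<Prod>i\<in>UNIV. d i) = 1" using dM by simp
  let ?m = "\<lambda>i. (1 + d i) / 2"
  have "(1/2) *\<^sub>R (A + B) = M ** diag ?m ** transpose M"
  proof -
    have m: "diag ?m = (1/2) *\<^sub>R (mat 1 + diag d)"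
      by (simp add: diag_def mat_def vec_eq_iff)
    have "A + B = M ** (mat 1 + diag d) ** transpose M"
      by (simp add: A' B' congruence_add)
    then show ?thesis
      by (simp add: m matrix_eq matrix_vector_mul_assoc[symmetric] scaleR_matrix_vector
          matrix_vector_mult_scaleR)
  qed
  then have det: "det ((1/2) *\<^sub>R (A + B)) = (det M)\<^sup>2 * (\<Prod>i\<in>UNIV. ?m i)"
    by (simp add: det_congruence)
  have am: "sqrt (d i) \<le> ?m i" for i
    using arith_geo_mean_sqrt[of 1 "d i"] d[of i] by simp
  obtain k where k: "d k \<noteq> 1"
  proof (rule ccontr)
    assume "\<not> thesis"
    then have "d = (\<lambda>i. 1)" using that by blast
    then have "A = B" by (simp add: A' B' diag_one)
    with ne show False ..
  qed
  have "0 < (sqrt (d k) - 1)\<^sup>2" using k by simp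
  then have amk: "sqrt (d k) < ?m k" using d[of k] by (simp add: power2_diff)
  have "(\<Prod>i\<in>UNIV. sqrt (d i))\<^sup>2 = 1"
    using d prod1 by (simp add: prod_power_distrib less_imp_le)
  moreover have "0 \<le> (\<Prod>i\<in>UNIV. sqrt (d i))" using d by (simp add: prod_nonneg less_imp_le)
  ultimately have "1 = (\<Prod>i\<in>UNIV. sqrt (d i))" by (auto simp: power2_eq_1_iff)
  also have "\<dots> = sqrt (d k) * (\<Prod>i\<in>UNIV - {k}. sqrt (d i))" by (simp add: prod.remove)
  also have "\<dots> < ?m k * (\<Prod>i\<in>UNIV - {k}. sqrt (d i))"
    using amk d by (intro mult_strict_right_mono prod_pos) auto
  also have "\<dots> \<le> ?m k * (\<Prod>i\<in>UNIV - {k}. ?m i)"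
    using am d by (intro mult_left_mono prod_mono) (auto simp: less_imp_le add_nonneg_nonneg)
  also have "\<dots> = (\<Prod>i\<in>UNIV. ?m i)" by (simp add: prod.remove)
  finally have "(det M)\<^sup>2 * 1 < (det M)\<^sup>2 * (\<Prod>i\<in>UNIV. ?m i)"
    using dM by (rule mult_strict_left_mono)
  then show ?thesis unfolding det by (simp add: A' det_mul power2_eq_square)
qed

subsection \<open>Ellipsoids\<close>

text \<open>For invertible \<open>L\<close> this is an ellipsoid whose matrix \<open>Q\<close> is
  the inverse of \<open>L ** transpose L\<close>. In this form volume is
  \<open>\<bar>det L\<bar>\<close> and the support function is easy to read off.\<close>

definition affine_ball :: "real^'n \<Rightarrow> real^'n^'n \<Rightarrow> (real^'n) set" where
  "affine_ball c L = (\<lambda>u. c + L *v u) ` cball 0 1"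

lemma ellipsoid_gram: "ellipsoid c (transpose N ** N) = {y. norm (N *v (y - c)) \<le> 1}"
  by (simp add: ellipsoid_def matrix_vector_mul_assoc[symmetric] norm_eq_sqrt_inner
      inner_matrix_vector_transpose[of _ "transpose N"])

lemma affine_ball_eq_ellipsoid:
  fixes L N :: "real^'n^'n"
  assumes "N ** L = mat 1"
  shows "affine_ball c L = ellipsoid c (transpose N ** N)"
proof -
  have LN: "L ** N = mat 1" using assms matrix_left_right_inverse by blast
  have "y \<in> affine_ball c L" if "norm (N *v (y - c)) \<le> 1" for y
  proof -
    have "y = c + L *v (N *v (y - c))" by (simp add: matrix_vector_mul_assoc LN)
    then show ?thesis unfolding affine_ball_def using that by (intro image_eqI) auto
  qed
  moreover have "norm (N *v (y - c)) \<le> 1" if "y \<in> affine_ball c L" for y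
    using that by (auto simp: affine_ball_def matrix_vector_mul_assoc assms)
  ultimately show ?thesis unfolding ellipsoid_gram by blast
qed

lemma
  fixes L :: "real^'n^'n"
  assumes "invertible L"
  shows is_ellipsoid_affine_ball: "is_ellipsoid (affine_ball c L)"
    and ell_center_affine_ball: "ell_center (affine_ball c L) = c"
    and ell_vol_affine_ball: "ell_vol (affine_ball c L) = \<bar>det L\<bar>"
proof -
  obtain N :: "real^'n^'n" where N: "N ** L = mat 1" "L ** N = mat 1" using assms unfolding invertible_def by blast
  then have "invertible N" unfolding invertible_def by blast
  then have spd: "sym_pos_def (transpose N ** N)" by (rule sym_pos_def_gram)
  note eq = affine_ball_eq_ellipsoid[OF N(1), of c]
  show "is_ellipsoid (affine_ball c L)" using spd eq unfolding is_ellipsoid_def by blast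
  show "ell_center (affine_ball c L) = c" using spd eq by (simp add: ell_center_ellipsoid)
  have "det N * det L = 1" by (metis N(1) det_mul det_I)
  then have "det N = inverse (det L)" by (metis inverse_unique mult.commute)
  then show "ell_vol (affine_ball c L) = \<bar>det L\<bar>"
    using spd assms unfolding eq
    by (simp add: ell_vol_ellipsoid det_mul powr_minus powr_half_sqrt invertible_det_nz
        inverse_mult_distrib[symmetric] real_sqrt_inverse del: inverse_mult_distrib)
qed

lemma is_ellipsoidE:
  assumes "is_ellipsoid E"
  obtains c and L :: "real^'n^'n" where "invertible L" "E = affine_ball c L"
proof -
  obtain c Q where Q: "sym_pos_def Q" "E = ellipsoid c Q"
    using assms unfolding is_ellipsoid_def by blast
  obtain T :: "real^'n^'n" where T: "invertible T" "Q = T ** transpose T" by (rule sym_pos_def_factor[OF Q(1)])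
  then have "invertible (transpose T)" by (simp add: transpose_invertible)
  then obtain L :: "real^'n^'n" where L: "transpose T ** L = mat 1" "L ** transpose T = mat 1"
    unfolding invertible_def by blast
  then have "invertible L" unfolding invertible_def by blast
  moreover have "E = affine_ball c L"
    using affine_ball_eq_ellipsoid[OF L(1), of c] T Q by simp
  ultimately show ?thesis using that by blast
qed

text \<open>The factor \<open>L\<close> is determined by the ellipsoid only up to an orthogonal
  factor on the right; the matrix in \<open>ellipsoid\<close> is the inverse of
  \<open>L ** transpose L\<close> and does not see it.\<close>

lemma affine_ball_cong:
  fixes L L' :: "real^'n^'n"
  assumes "invertible L" "invertible L'" and eq: "L ** transpose L = L' ** transpose L'"
  shows "affine_ball c L = affine_ball c L'"
proof -
  obtain N :: "real^'n^'n" where N: "N ** L = mat 1" "L ** N = mat 1" using assms unfolding invertible_def by blast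
  obtain N' :: "real^'n^'n" where N': "N' ** L' = mat 1" "L' ** N' = mat 1" using assms unfolding invertible_def by blast
  have l: "(transpose N' ** N') ** (L' ** transpose L') = mat 1"
    by (metis N' matrix_mul_assoc matrix_mul_rid matrix_transpose_mul transpose_mat)
  have r: "(L ** transpose L) ** (transpose N ** N) = mat 1"
    by (metis N matrix_mul_assoc matrix_mul_rid matrix_transpose_mul transpose_mat)
  have "transpose N' ** N' = transpose N ** N"
    by (metis l r eq matrix_mul_assoc matrix_mul_lid matrix_mul_rid)
  then show ?thesis
    by (simp add: affine_ball_eq_ellipsoid[OF N(1)] affine_ball_eq_ellipsoid[OF N'(1)])
qed

text \<open>The left side of the inequality is the support function of the ellipsoid in direction
  \<open>a\<close>: the maximum of \<open>a \<bullet> (L *v u)\<close> over the unit ball is the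
  norm of \<open>transpose L *v a\<close>.\<close>

lemma affine_ball_subset_polar_iff:
  fixes L :: "real^'n^'n"
  shows "affine_ball c L \<subseteq> polar A \<longleftrightarrow>
    (\<forall>a\<in>A. a \<bullet> c + sqrt (a \<bullet> ((L ** transpose L) *v a)) \<le> 1)"
proof -
  have q: "sqrt (a \<bullet> ((L ** transpose L) *v a)) = norm (transpose L *v a)" for a
    by (simp add: matrix_vector_mul_assoc[symmetric] inner_matrix_vector_transpose[of a L]
        norm_eq_sqrt_inner)
  have "(\<forall>u\<in>cball 0 1. (c + L *v u) \<bullet> a \<le> 1) \<longleftrightarrow> a \<bullet> c + norm (transpose L *v a) \<le> 1"
    (is "?l \<longleftrightarrow> ?r") for a
  proof
    let ?v = "transpose L *v a"
    assume l: ?l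
    \<comment> \<open>If \<open>?v = 0\<close>, division by zero makes \<open>u = 0\<close>, which
      still attains the maximum.\<close>
    define u where "u = (1 / norm ?v) *\<^sub>R ?v"
    have "u \<in> cball 0 1" by (simp add: u_def)
    with l have "a \<bullet> c + a \<bullet> (L *v u) \<le> 1" by (metis inner_add_right inner_commute)
    moreover have "a \<bullet> (L *v u) = norm ?v"
      by (simp add: inner_matrix_vector_transpose[of a L] u_def dot_square_norm power2_eq_square)
    ultimately show ?r by simp
  next
    assume r: ?r
    show ?l
    proof
      fix u :: "real^'n" assume u: "u \<in> cball 0 1"
      have "a \<bullet> (L *v u) \<le> norm (transpose L *v a) * norm u"
        unfolding inner_matrix_vector_transpose by (rule norm_cauchy_schwarz)
      also have "\<dots> \<le> norm (transpose L *v a)" using u by (simp add: mult_left_le)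
      finally show "(c + L *v u) \<bullet> a \<le> 1"
        using r by (simp add: inner_add_right inner_commute[of _ a])
    qed
  qed
  then show ?thesis unfolding q by (auto simp: affine_ball_def polar_def image_subset_iff)
qed

text \<open>By central symmetry both \<open>c + L *v e\<close> and \<open>c - L *v e\<close> lie in
  the ball, so half their difference has norm at most \<rho> wherever \<open>c\<close> is. This
  bounds the operator norm of \<open>L\<close>, hence that of its transpose.\<close>

lemma affine_ball_subset_cball:
  fixes L :: "real^'n^'n"
  assumes "affine_ball c L \<subseteq> cball 0 \<rho>"
  shows "norm c \<le> \<rho>" "u \<bullet> ((L ** transpose L) *v u) \<le> \<rho>\<^sup>2 * (u \<bullet> u)"
proof -
  have in_ball: "norm (c + L *v v) \<le> \<rho>" if "norm v \<le> 1" for v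
    using assms that by (force simp: affine_ball_def)
  show "norm c \<le> \<rho>" using in_ball[of 0] by simp
  then have \<rho>: "\<rho> \<ge> 0" using norm_ge_zero order_trans by blast
  define v where "v = transpose L *v u"
  have q: "u \<bullet> ((L ** transpose L) *v u) = (norm v)\<^sup>2"
    by (simp add: matrix_vector_mul_assoc[symmetric] inner_matrix_vector_transpose[of u L] v_def
        dot_square_norm)
  define e where "e = (1 / norm v) *\<^sub>R v"
  have "norm e \<le> 1" by (simp add: e_def)
  have Le: "norm (L *v e) \<le> \<rho>"
  proof -
    have "L *v (- e) = - (L *v e)" using matrix_vector_mult_scaleR[of L "-1" e] by simp
    then have "2 *\<^sub>R (L *v e) = (c + L *v e) - (c + L *v (- e))" by (simp add: scaleR_2)
    then have "norm (2 *\<^sub>R (L *v e)) \<le> \<rho> + \<rho>"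
      using in_ball[OF \<open>norm e \<le> 1\<close>] in_ball[of "- e"] \<open>norm e \<le> 1\<close>
        norm_triangle_ineq4[of "c + L *v e" "c + L *v (- e)"] by simp
    then show ?thesis by simp
  qed
  have "norm v = u \<bullet> (L *v e)"
    by (simp add: inner_matrix_vector_transpose[of u L] v_def[symmetric] e_def dot_square_norm
        power2_eq_square)
  also have "\<dots> \<le> norm u * norm (L *v e)" by (rule norm_cauchy_schwarz)
  also have "\<dots> \<le> norm u * \<rho>" using Le by (simp add: mult_left_mono)
  finally have "(norm v)\<^sup>2 \<le> (norm u * \<rho>)\<^sup>2" by (rule power_mono) simp
  then show "u \<bullet> ((L ** transpose L) *v u) \<le> \<rho>\<^sup>2 * (u \<bullet> u)"
    unfolding q by (simp add: power_mult_distrib dot_square_norm mult.commute)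
qed

section \<open>Inscribed ellipsoids: interpolation, growth, uniqueness\<close>

text \<open>Containment in \<open>polar A\<close>, written through support functions.
  \<open>S\<close> is the inverse of the matrix in \<open>ellipsoid\<close>, so \<open>det S\<close>
  is the squared volume and is to be maximized; \<open>sqrt (a \<bullet> (S *v a))\<close> is the
  half-width in direction \<open>a\<close>.\<close>

definition inscribed :: "(real^'n) set \<Rightarrow> real^'n \<Rightarrow> real^'n^'n \<Rightarrow> bool" where
  "inscribed A c S \<longleftrightarrow> sym_pos_def S \<and> (\<forall>a\<in>A. a \<bullet> c + sqrt (a \<bullet> (S *v a)) \<le> 1)"

lemma inscribed_affine_ball_iff:
  fixes L :: "real^'n^'n"
  assumes "invertible L"
  shows "inscribed A c (L ** transpose L) \<longleftrightarrow> affine_ball c L \<subseteq> polar A"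
  using sym_pos_def_gram[of "transpose L"] assms
  by (simp add: inscribed_def affine_ball_subset_polar_iff transpose_invertible)

lemma inscribed_factor:
  fixes S :: "real^'n^'n"
  assumes "inscribed A c S"
  obtains L :: "real^'n^'n" where "invertible L" "S = L ** transpose L" "affine_ball c L \<subseteq> polar A"
proof -
  obtain L :: "real^'n^'n" where L: "invertible L" "S = L ** transpose L"
    using assms sym_pos_def_factor unfolding inscribed_def by blast
  then show ?thesis using that inscribed_affine_ball_iff assms by blast
qed

lemma inscribed_bounds:
  assumes "inscribed A c S" "polar A \<subseteq> cball 0 \<rho>"
  shows "norm c \<le> \<rho>" "u \<bullet> (S *v u) \<le> \<rho>\<^sup>2 * (u \<bullet> u)"
proof -
  obtain L where L: "invertible L" "S = L ** transpose L" "affine_ball c L \<subseteq> polar A"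
    using assms(1) by (rule inscribed_factor)
  then have "affine_ball c L \<subseteq> cball 0 \<rho>" using assms(2) by blast
  from affine_ball_subset_cball[OF this] L
  show "norm c \<le> \<rho>" "u \<bullet> (S *v u) \<le> \<rho>\<^sup>2 * (u \<bullet> u)" by auto
qed

text \<open>The two bounded quantities are \<open>m + w\<close> and \<open>m - w\<close>, so
  \<open>m + \<bar>w\<bar> \<le> s\<close> and m^2 + w^2 is at most s^2. What m^2 + w^2 has beyond
  the claimed left side is half a square.\<close>

lemma shifted_product_le_square:
  fixes p q s t :: real
  assumes "p \<ge> 0" "q \<ge> 0" "p + t \<le> s" "q - t \<le> s"
  shows "p * q + t\<^sup>2 / 2 \<le> s\<^sup>2"
proof -
  define m w where "m = (p + q) / 2" and "w = t + (p - q) / 2"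
  have m: "m \<ge> 0" using assms by (simp add: m_def)
  have w: "\<bar>w\<bar> \<le> s - m" using assms by (auto simp: m_def w_def abs_le_iff field_simps)
  have "m\<^sup>2 + w\<^sup>2 \<le> m\<^sup>2 + (s - m)\<^sup>2"
    using w by (simp add: abs_le_square_iff[symmetric])
  also have "\<dots> \<le> s\<^sup>2"
    using mult_nonneg_nonneg[of m "s - m"] m w by (simp add: power2_eq_square algebra_simps)
  finally have "m\<^sup>2 + w\<^sup>2 \<le> s\<^sup>2" .
  moreover have "m\<^sup>2 + w\<^sup>2 - (p * q + t\<^sup>2 / 2) = (t + (p - q))\<^sup>2 / 2"
    by (simp add: m_def w_def power2_eq_square field_simps)
  ultimately show ?thesis by (smt (verit) zero_le_power2 divide_nonneg_nonneg)
qed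

text \<open>With \<open>p\<close>, \<open>q\<close> the half-widths of the two ellipsoids in direction \<open>a\<close> and \<open>t\<close> half the
  displacement of the centers, the slack at the midpoint is the \<open>s\<close> of
  \<open>shifted_product_le_square\<close>.\<close>

lemma inscribed_geometric_midpoint:
  assumes 1: "inscribed A c1 S1" and 2: "inscribed A c2 S2" and G: "sym_pos_def G"
    and le: "\<And>u. u \<bullet> (G *v u) \<le> sqrt (u \<bullet> (S1 *v u)) * sqrt (u \<bullet> (S2 *v u))"
  shows "inscribed A ((1/2) *\<^sub>R (c1 + c2)) (G + outer ((1 / sqrt 8) *\<^sub>R (c1 - c2)))"
  unfolding inscribed_def
proof (intro conjI ballI)
  show "sym_pos_def (G + outer ((1 / sqrt 8) *\<^sub>R (c1 - c2)))"
    using G by (rule sym_pos_def_add_outer)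
  fix a assume a: "a \<in> A"
  define p q where "p = sqrt (a \<bullet> (S1 *v a))" and "q = sqrt (a \<bullet> (S2 *v a))"
  define t where "t = (a \<bullet> c1 - a \<bullet> c2) / 2"
  define s where "s = 1 - (a \<bullet> c1 + a \<bullet> c2) / 2"
  have nonneg: "0 \<le> a \<bullet> (S1 *v a)" "0 \<le> a \<bullet> (S2 *v a)"
    using 1 2 by (simp_all add: inscribed_def sym_pos_def_nonneg)
  then have pq: "p \<ge> 0" "q \<ge> 0" by (simp_all add: p_def q_def)
  have ts: "p + t \<le> s" "q - t \<le> s"
    using 1 2 a by (auto simp: inscribed_def p_def q_def t_def s_def field_simps)
  then have "s \<ge> 0" using pq by linarith
  \<comment> \<open>As \<open>a \<bullet> (c1 - c2) = 2 * t\<close>, the rank-one term contributes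
    (2 t)^2 / 8. The factor \<open>1 / sqrt 8\<close> is thus chosen to use up exactly the surplus
    t^2 / 2 of \<open>shifted_product_le_square\<close>.\<close>
  have "a \<bullet> ((G + outer ((1 / sqrt 8) *\<^sub>R (c1 - c2))) *v a) = a \<bullet> (G *v a) + t\<^sup>2 / 2"
    by (simp add: matrix_vector_mult_add_rdistrib inner_add_right inner_diff_left inner_diff_right
        t_def power2_eq_square inner_commute[of _ a] field_simps)
  also have "\<dots> \<le> p * q + t\<^sup>2 / 2" using le[of a] by (simp add: p_def q_def)
  also have "\<dots> \<le> s\<^sup>2" using shifted_product_le_square[OF pq ts] .
  finally have "sqrt (a \<bullet> ((G + outer ((1 / sqrt 8) *\<^sub>R (c1 - c2))) *v a)) \<le> s"
    using \<open>s \<ge> 0\<close> by (simp add: real_le_lsqrt)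
  then show "a \<bullet> ((1/2) *\<^sub>R (c1 + c2)) + sqrt (a \<bullet> ((G + outer ((1 / sqrt 8) *\<^sub>R (c1 - c2))) *v a)) \<le> 1"
    by (simp add: s_def inner_add_right)
qed

text \<open>The interpolated ellipsoid has determinant at least \<open>det G * (1 + x)\<close> and,
  by maximality, at most \<open>det S1\<close>. Squaring replaces the geometric mean by
  \<open>det S1 * det S2\<close>, and one factor \<open>det S1\<close> cancels; this is where the
  square in the conclusion comes from.\<close>

lemma inscribed_growth:
  assumes 1: "inscribed A c1 S1" and 2: "inscribed A c2 S2"
    and max: "\<And>c S. inscribed A c S \<Longrightarrow> det S \<le> det S1"
    and \<rho>: "\<rho> > 0" "polar A \<subseteq> cball 0 \<rho>"
  shows "det S2 * (1 + (norm (c1 - c2))\<^sup>2 / (8 * \<rho>\<^sup>2))\<^sup>2 \<le> det S1"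
proof -
  have S: "sym_pos_def S1" "sym_pos_def S2" using 1 2 by (simp_all add: inscribed_def)
  note pos = sym_pos_def_det_pos[OF S(1)] sym_pos_def_det_pos[OF S(2)]
  obtain G where G: "sym_pos_def G" "(det G)\<^sup>2 = det S1 * det S2"
    and le: "\<And>u. u \<bullet> (G *v u) \<le> sqrt (u \<bullet> (S1 *v u)) * sqrt (u \<bullet> (S2 *v u))"
    using sym_pos_def_geometric_mean[OF S] by blast
  define z where "z = (1 / sqrt 8) *\<^sub>R (c1 - c2)"
  define x where "x = (norm (c1 - c2))\<^sup>2 / (8 * \<rho>\<^sup>2)"
  have x: "(z \<bullet> z) / \<rho>\<^sup>2 = x"
    by (simp add: z_def x_def dot_square_norm power_divide)
  have "x \<ge> 0" by (simp add: x_def)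
  have "z \<bullet> (G *v z) \<le> sqrt (\<rho>\<^sup>2 * (z \<bullet> z)) * sqrt (\<rho>\<^sup>2 * (z \<bullet> z))"
    using inscribed_bounds(2)[OF 1 \<rho>(2), of z] inscribed_bounds(2)[OF 2 \<rho>(2), of z]
    by (intro order_trans[OF le] mult_mono real_sqrt_le_mono) 
      (auto intro: sym_pos_def_nonneg S)
  then have "z \<bullet> (G *v z) \<le> \<rho>\<^sup>2 * (z \<bullet> z)" by simp
  then have "det G * (1 + x) \<le> det (G + outer z)"
    using det_add_outer_ge[OF G(1), of "\<rho>\<^sup>2" z] \<rho> by (simp add: x)
  also have "\<dots> \<le> det S1"
    using max inscribed_geometric_midpoint[OF 1 2 G(1) le] unfolding z_def by blast
  finally have "(det G * (1 + x))\<^sup>2 \<le> (det S1)\<^sup>2"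
    using sym_pos_def_det_pos[OF G(1)] \<open>x \<ge> 0\<close> by (intro power_mono) auto
  then have "det S1 * (det S2 * (1 + x)\<^sup>2) \<le> det S1 * det S1"
    by (simp add: power_mult_distrib G(2) power2_eq_square[of "det S1"] mult_ac)
  then show ?thesis using pos by (simp add: x_def mult_le_cancel_left_pos)
qed

lemma inscribed_midpoint:
  assumes 1: "inscribed A c S1" and 2: "inscribed A c S2"
  shows "inscribed A c ((1/2) *\<^sub>R (S1 + S2))"
  unfolding inscribed_def
proof (intro conjI ballI)
  show "sym_pos_def ((1/2) *\<^sub>R (S1 + S2))"
    using 1 2 by (simp add: inscribed_def sym_pos_def_midpoint)
  fix a assume a: "a \<in> A"
  have "a \<bullet> (((1/2) *\<^sub>R (S1 + S2)) *v a) \<le> max (a \<bullet> (S1 *v a)) (a \<bullet> (S2 *v a))"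
    by (simp add: scaleR_matrix_vector matrix_vector_mult_add_rdistrib inner_add_right)
  then have "sqrt (a \<bullet> (((1/2) *\<^sub>R (S1 + S2)) *v a)) \<le> sqrt (max (a \<bullet> (S1 *v a)) (a \<bullet> (S2 *v a)))"
    by (rule real_sqrt_le_mono)
  moreover have "a \<bullet> c + sqrt (a \<bullet> (S1 *v a)) \<le> 1" "a \<bullet> c + sqrt (a \<bullet> (S2 *v a)) \<le> 1"
    using 1 2 a by (auto simp: inscribed_def)
  ultimately show "a \<bullet> c + sqrt (a \<bullet> (((1/2) *\<^sub>R (S1 + S2)) *v a)) \<le> 1"
    by (cases "a \<bullet> (S1 *v a) \<le> a \<bullet> (S2 *v a)"; simp only: max_def if_True if_False; linarith)
qed

text \<open>Equal determinants leave no room for the growth factor, so the centers agree. With a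
  common center the arithmetic midpoint of the shapes is inscribed too, and by
  \<open>det_midpoint_strict\<close> it would be larger if the shapes differed.\<close>

lemma inscribed_maximal_unique:
  assumes 1: "inscribed A c1 S1" and 2: "inscribed A c2 S2" and eq: "det S1 = det S2"
    and max: "\<And>c S. inscribed A c S \<Longrightarrow> det S \<le> det S1"
    and bdd: "bounded (polar A)"
  shows "c1 = c2 \<and> S1 = S2"
proof -
  obtain \<rho> where \<rho>: "\<rho> > 0" "polar A \<subseteq> cball 0 \<rho>"
    using bdd by (metis bounded_subset_ballD ball_subset_cball subset_trans)
  have pos: "det S2 > 0" using 2 by (simp add: inscribed_def sym_pos_def_det_pos)
  define x where "x = (norm (c1 - c2))\<^sup>2 / (8 * \<rho>\<^sup>2)"
  have "x \<ge> 0" by (simp add: x_def)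
  have "det S2 * (1 + x)\<^sup>2 \<le> det S2 * 1"
    using inscribed_growth[OF 1 2 max \<rho>] eq by (simp add: x_def)
  then have "(1 + x)\<^sup>2 \<le> 1" using pos by simp
  then have "x = 0" using \<open>x \<ge> 0\<close> by (simp add: power2_eq_square algebra_simps) (smt (verit) mult_nonneg_nonneg)
  then have c: "c1 = c2" using \<rho> by (simp add: x_def)
  have "S1 = S2"
  proof (rule ccontr)
    assume "S1 \<noteq> S2"
    then have "det S1 < det ((1/2) *\<^sub>R (S1 + S2))"
      using det_midpoint_strict[OF _ _ eq] 1 2 unfolding inscribed_def by blast
    then show False using max inscribed_midpoint 1 2 c by (metis leD)
  qed
  with c show ?thesis ..
qed

lemma continuous_on_det: "continuous_on T (\<lambda>p. det (fst p :: real^'n^'n))"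
  unfolding det_def by (intro continuous_intros)

subsection \<open>Extremal ellipsoids\<close>

text \<open>Covers both problems: \<open>K\<close> the unit ball for \<open>MaxIE T\<close>, \<open>T\<close> the unit ball for \<open>MinCE K\<close>.\<close>

lemma ex_max_det_affine:
  fixes K T :: "(real^'n) set"
  assumes T: "compact T" and K: "interior K \<noteq> {}" and ex: "\<And>y. y \<in> K \<Longrightarrow> N0 *v y + b0 \<in> T"
  obtains N b where "\<And>y. y \<in> K \<Longrightarrow> N *v y + b \<in> T"
    "\<And>N' b'. (\<And>y. y \<in> K \<Longrightarrow> N' *v y + b' \<in> T) \<Longrightarrow> \<bar>det N'\<bar> \<le> \<bar>det N\<bar>"
proof -
  define C :: "((real^'n^'n) \<times> (real^'n)) set" where
    "C = (\<Inter>y\<in>K. (\<lambda>p. fst p *v y + snd p) -` T)"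
  have lin: "linear (\<lambda>p :: (real^'n^'n) \<times> (real^'n). fst p *v y + snd p)" for y
    by (intro linearI) (auto simp: matrix_vector_mult_add_rdistrib scaleR_matrix_vector algebra_simps)
  have "closed C"
    unfolding C_def using T
    by (intro closed_INT ballI continuous_closed_vimage compact_imp_closed
        linear_continuous_at) (auto simp: linear_linear lin)
  \<comment> \<open>A ball of radius \<open>r\<close> in \<open>K\<close> controls \<open>N\<close>:
    the images of its center \<open>p\<close> and of \<open>p + (r/2) *\<^sub>R axis j 1\<close>
    have norm at most \<tau>, so \<open>r / 2\<close> times column \<open>j\<close> has norm at most
    2 \<tau>, whence the constant \<open>B\<close>. The image of \<open>p\<close> then controls
    \<open>b\<close>.\<close>
  moreover have "bounded C"
  proof -
    obtain p r where r: "r > 0" "ball p r \<subseteq> K" using K by (metis all_not_in_conv mem_interior)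
    obtain \<tau> where \<tau>: "\<And>x. x \<in> T \<Longrightarrow> norm x \<le> \<tau>"
      using T compact_imp_bounded bounded_iff by metis
    define B where "B = 4 * \<tau> / r"
    have "norm p' \<le> real CARD('n) * (real CARD('n) * B) + (\<tau> + real (CARD('n) * CARD('n)) * B * norm p)"
      if "p' \<in> C" for p'
    proof -
      obtain N b where p': "p' = (N, b)" by (cases p')
      have inT: "N *v y + b \<in> T" if "y \<in> K" for y using \<open>p' \<in> C\<close> that by (auto simp: C_def p')
      have pK: "p \<in> K" using r by auto
      have col: "\<bar>N $ i $ j\<bar> \<le> B" for i j
      proof -
        have "p + (r/2) *\<^sub>R axis j 1 \<in> K" using r by (auto simp: dist_norm)
        from norm_triangle_le_diff[OF add_mono[OF \<tau>[OF inT[OF this]] \<tau>[OF inT[OF pK]]]]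
        have "norm ((r/2) *\<^sub>R column j N) \<le> \<tau> + \<tau>"
          by (simp add: matrix_vector_right_distrib matrix_vector_mult_scaleR matrix_vector_mult_basis)
        then have "norm (column j N) \<le> B" using r by (simp add: B_def field_simps)
        then show ?thesis using component_le_norm_cart[of "column j N" i] by (simp add: column_def)
      qed
      have "norm N \<le> (\<Sum>i\<in>UNIV. norm (N $ i))" 
        unfolding norm_vec_def[of N] by (rule L2_set_le_sum) simp
      also have "\<dots> \<le> (\<Sum>i\<in>(UNIV::'n set). real CARD('n) * B)"
      proof (rule sum_mono)
        fix i :: 'n
        have "norm (N $ i) \<le> (\<Sum>j\<in>UNIV. \<bar>N $ i $ j\<bar>)" by (rule norm_le_l1_cart)
        also have "\<dots> \<le> (\<Sum>j\<in>(UNIV::'n set). B)" by (intro sum_mono col)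
        finally show "norm (N $ i) \<le> real CARD('n) * B" by simp
      qed
      finally have N: "norm N \<le> real CARD('n) * (real CARD('n) * B)" by simp
      have "norm (N *v p) \<le> onorm ((*v) N) * norm p"
        by (rule onorm) simp
      also have "\<dots> \<le> real (CARD('n) * CARD('n)) * B * norm p"
        using onorm_le_matrix_component[of N B] col by (intro mult_right_mono) auto
      finally have Np: "norm (N *v p) \<le> real (CARD('n) * CARD('n)) * B * norm p" .
      have "norm b \<le> norm (N *v p + b) + norm (N *v p)"
        using norm_triangle_ineq4[of "N *v p + b" "N *v p"] by simp
      also have "\<dots> \<le> \<tau> + real (CARD('n) * CARD('n)) * B * norm p"
        using \<tau>[OF inT[OF pK]] Np by simp
      finally show ?thesis using N norm_Pair_le[of N b] unfolding p' by linarith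
    qed
    then show ?thesis unfolding bounded_iff by blast
  qed
  ultimately have "compact C" by (simp add: compact_eq_bounded_closed)
  moreover have "(N0, b0) \<in> C" using ex by (auto simp: C_def)
  ultimately obtain q where q: "q \<in> C" "\<And>q'. q' \<in> C \<Longrightarrow> \<bar>det (fst q')\<bar> \<le> \<bar>det (fst q)\<bar>"
    using continuous_attains_sup[of C "\<lambda>p. \<bar>det (fst p)\<bar>"] continuous_on_rabs[OF continuous_on_det]
    by (metis empty_iff)
  show ?thesis
  proof (rule that[of "fst q" "snd q"])
    show "fst q *v y + snd q \<in> T" if "y \<in> K" for y using q(1) that by (auto simp: C_def)
    show "\<bar>det N'\<bar> \<le> \<bar>det (fst q)\<bar>" if "\<And>y. y \<in> K \<Longrightarrow> N' *v y + b' \<in> T" for N' b'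
      using q(2)[of "(N', b')"] that by (auto simp: C_def)
  qed
qed

lemma closed_polar: "closed (polar A)"
proof -
  have "polar A = (\<Inter>s\<in>A. {y. y \<bullet> s \<le> 1})" by (auto simp: polar_def)
  then show ?thesis by (auto simp: closed_halfspace_component_le inner_commute
      intro!: closed_INT closed_halfspace_le)
qed

text \<open>Resolves the definite description in \<open>MaxIE\<close>: existence comes from
  compactness, uniqueness from \<open>inscribed_maximal_unique\<close>, and optimality is restated
  for pairs \<open>(c, S)\<close>.\<close>

lemma MaxIE_polar:
  fixes A :: "(real^'n) set"
  assumes bdd: "bounded (polar A)" and int: "interior (polar A) \<noteq> {}"
  obtains c S where "inscribed A c S" "\<forall>c' S'. inscribed A c' S' \<longrightarrow> det S' \<le> det S"
    "ell_center (MaxIE (polar A)) = c"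
proof -
  have cpt: "compact (polar A)" using bdd closed_polar compact_eq_bounded_closed by blast
  obtain p r where r: "r > 0" "cball p r \<subseteq> polar A"
    using int by (metis all_not_in_conv mem_interior_cball)
  have sub_iff: "affine_ball c L \<subseteq> polar A \<longleftrightarrow> (\<forall>u\<in>cball 0 1. L *v u + c \<in> polar A)"
    for c :: "real^'n" and L
    by (auto simp: affine_ball_def add.commute)
  have start: "(r *\<^sub>R mat 1) *v u + p \<in> polar A" if "u \<in> cball 0 1" for u :: "real^'n"
  proof -
    have "(r *\<^sub>R mat 1) *v u + p \<in> cball p r"
      using that r by (simp add: scaleR_matrix_vector dist_norm mult_left_le)
    then show ?thesis using r by blast
  qed
  have "interior (cball 0 1 :: (real^'n) set) \<noteq> {}" by simp
  from ex_max_det_affine[OF cpt this start]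
  obtain L c where feas: "\<And>u. u \<in> cball 0 1 \<Longrightarrow> L *v u + c \<in> polar A"
    and max: "\<And>L' c'. (\<And>u. u \<in> cball 0 1 \<Longrightarrow> L' *v u + c' \<in> polar A) \<Longrightarrow> \<bar>det L'\<bar> \<le> \<bar>det L\<bar>"
    by blast
  \<comment> \<open>The maximization also admits singular maps; comparison with the small ball
    inside the polar shows that the maximizer is not one of them.\<close>
  have "0 < \<bar>det (r *\<^sub>R mat 1 :: real^'n^'n)\<bar>" using r by (simp add: det_scaleR)
  also have "\<dots> \<le> \<bar>det L\<bar>" using max[of "r *\<^sub>R mat 1" p] start by blast
  finally have L: "invertible L" by (simp add: invertible_det_nz)
  have sub: "affine_ball c L \<subseteq> polar A" using feas sub_iff by blast
  define S where "S = L ** transpose L"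
  have ins: "inscribed A c S" unfolding S_def using inscribed_affine_ball_iff[OF L] sub by blast
  have maxS: "det S' \<le> det S" if S': "inscribed A c' S'" for c' S'
  proof -
    obtain L' where L': "invertible L'" "S' = L' ** transpose L'" "affine_ball c' L' \<subseteq> polar A"
      using S' by (rule inscribed_factor)
    then have "\<bar>det L'\<bar> \<le> \<bar>det L\<bar>" using max sub_iff by blast
    then have "(det L')\<^sup>2 \<le> (det L)\<^sup>2" by (simp add: abs_le_square_iff)
    then show ?thesis by (simp add: S_def L' det_mul power2_eq_square)
  qed
  have "MaxIE (polar A) = affine_ball c L"
    unfolding MaxIE_def
  proof (rule the_equality)
    show "is_ellipsoid (affine_ball c L) \<and> affine_ball c L \<subseteq> polar A \<and>
      (\<forall>F. is_ellipsoid F \<and> F \<subseteq> polar A \<longrightarrow> ell_vol F \<le> ell_vol (affine_ball c L))"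
    proof (intro conjI allI impI)
      fix F assume F: "is_ellipsoid F \<and> F \<subseteq> polar A"
      then obtain c' L' where L': "invertible L'" "F = affine_ball c' L'"
        using is_ellipsoidE by blast
      then have "\<bar>det L'\<bar> \<le> \<bar>det L\<bar>" using max sub_iff F by blast
      then show "ell_vol F \<le> ell_vol (affine_ball c L)" by (simp add: L' L ell_vol_affine_ball)
    qed (use L sub in \<open>simp_all add: is_ellipsoid_affine_ball\<close>)
  next
    fix E assume E: "is_ellipsoid E \<and> E \<subseteq> polar A \<and>
      (\<forall>F. is_ellipsoid F \<and> F \<subseteq> polar A \<longrightarrow> ell_vol F \<le> ell_vol E)"
    then have "is_ellipsoid E" by blast
    then obtain c' and L' :: "real^'n^'n" where L': "invertible L'" "E = affine_ball c' L'"
      by (rule is_ellipsoidE)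
    have ins': "inscribed A c' (L' ** transpose L')"
      using inscribed_affine_ball_iff[OF L'(1)] E L'(2) by blast
    have "ell_vol (affine_ball c L) \<le> ell_vol E"
      using E is_ellipsoid_affine_ball[OF L] sub by blast
    then have "\<bar>det L\<bar> \<le> \<bar>det L'\<bar>" by (simp add: L' L ell_vol_affine_ball)
    then have "(det L)\<^sup>2 \<le> (det L')\<^sup>2" by (simp add: abs_le_square_iff)
    then have "det S \<le> det (L' ** transpose L')" by (simp add: S_def det_mul power2_eq_square)
    then have "det S = det (L' ** transpose L')" using maxS[OF ins'] by simp
    from inscribed_maximal_unique[OF ins ins' this maxS bdd]
    have "c = c'" "L ** transpose L = L' ** transpose L'" by (simp_all add: S_def)
    then show "E = affine_ball c L"
      unfolding L'(2) using affine_ball_cong[OF L'(1) L] by simp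
  qed
  then have "ell_center (MaxIE (polar A)) = c" using L by (simp add: ell_center_affine_ball)
  with maxS show ?thesis by (intro that[OF ins]) auto
qed

section \<open>Minimal enclosing ellipsoids\<close>

lemma ell_vol_le_iff:
  assumes "sym_pos_def Q" "sym_pos_def R"
  shows "ell_vol (ellipsoid c Q) \<le> ell_vol (ellipsoid d R) \<longleftrightarrow> det R \<le> det Q"
  using sym_pos_def_det_pos[OF assms(1)] sym_pos_def_det_pos[OF assms(2)]
  by (simp add: assms ell_vol_ellipsoid powr_minus powr_half_sqrt)

lemma quad_expand:
  fixes Q :: "real^'n^'n"
  assumes "sym_pos_def Q"
  shows "(d + e) \<bullet> (Q *v (d + e)) = d \<bullet> (Q *v d) + 2 * (d \<bullet> (Q *v e)) + e \<bullet> (Q *v e)"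
  using symmetric_inner[of Q e d] assms
  by (simp add: sym_pos_def_def matrix_vector_right_distrib inner_add_left inner_add_right)

lemma enclosing_midpoint:
  fixes Q1 Q2 :: "real^'n^'n"
  assumes Q: "sym_pos_def Q1" "sym_pos_def Q2" and K: "K \<subseteq> ellipsoid c1 Q1" "K \<subseteq> ellipsoid c2 Q2"
  obtains c where "K \<subseteq> ellipsoid c ((1/2) *\<^sub>R (Q1 + Q2))"
proof -
  let ?Q = "(1/2) *\<^sub>R (Q1 + Q2)"
  have "invertible ?Q"
    using sym_pos_def_det_pos[OF sym_pos_def_midpoint[OF Q]] invertible_det_nz by (metis less_irrefl)
  then obtain R where R: "?Q ** R = mat 1" unfolding invertible_def by blast
  define c where "c = R *v ((1/2) *\<^sub>R (Q1 *v c1 + Q2 *v c2))"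
  have "?Q *v c = (1/2) *\<^sub>R (Q1 *v c1 + Q2 *v c2)"
    unfolding c_def by (simp only: matrix_vector_mul_assoc R matrix_vector_mul_lid)
  then have "(Q1 + Q2) *v c = Q1 *v c1 + Q2 *v c2"
    by (simp add: scaleR_matrix_vector)
  then have crit: "Q1 *v (c - c1) + Q2 *v (c - c2) = 0"
    by (simp add: matrix_vector_mult_add_rdistrib matrix_vector_mult_diff_distrib) (simp add: algebra_simps)
  have "y \<in> ellipsoid c ?Q" if "y \<in> K" for y
  proof -
    define d where "d = y - c"
    have "(d + (c - c1)) \<bullet> (Q1 *v (d + (c - c1))) \<le> 1" "(d + (c - c2)) \<bullet> (Q2 *v (d + (c - c2))) \<le> 1"
      using that K by (auto simp: ellipsoid_def d_def)
    moreover have "d \<bullet> (Q1 *v (c - c1)) + d \<bullet> (Q2 *v (c - c2)) = 0"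
      using crit by (metis inner_add_right inner_zero_right)
    ultimately have "d \<bullet> (Q1 *v d) + d \<bullet> (Q2 *v d) \<le> 2"
      using sym_pos_def_nonneg[OF Q(1), of "c - c1"] sym_pos_def_nonneg[OF Q(2), of "c - c2"]
      unfolding quad_expand[OF Q(1)] quad_expand[OF Q(2)] by linarith
    then show ?thesis
      by (simp add: ellipsoid_def d_def scaleR_matrix_vector matrix_vector_mult_add_rdistrib inner_add_right)
  qed
  then show ?thesis using that by blast
qed

text \<open>Averaging the two membership inequalities around the midpoint of the centers gains the
  constant \<open>k\<close>, by the parallelogram identity. So \<open>K\<close> fits into a smaller
  concentric ellipsoid, against maximality of \<open>det Q\<close>.\<close>

lemma enclosing_center_unique:
  fixes Q :: "real^'n^'n"
  assumes Q: "sym_pos_def Q" and K: "K \<subseteq> ellipsoid c1 Q" "K \<subseteq> ellipsoid c2 Q"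
    and max: "\<And>c R. sym_pos_def R \<Longrightarrow> K \<subseteq> ellipsoid c R \<Longrightarrow> det R \<le> det Q"
  shows "c1 = c2"
proof (rule ccontr)
  assume "c1 \<noteq> c2"
  define e where "e = (1/2) *\<^sub>R (c2 - c1)"
  define c where "c = (1/2) *\<^sub>R (c1 + c2)"
  have ce: "c1 = c - e" "c2 = c - (- e)"
    by (simp_all add: c_def e_def vec_eq_iff field_simps)
  define k where "k = e \<bullet> (Q *v e)"
  have "e \<noteq> 0" using \<open>c1 \<noteq> c2\<close> by (simp add: e_def)
  then have k: "k > 0" using Q by (simp add: sym_pos_def_def k_def)
  have neg: "Q *v (- e) = - (Q *v e)" using matrix_vector_mult_scaleR[of Q "-1" e] by simp
  have "y \<in> ellipsoid c ((1 + k) *\<^sub>R Q)" if "y \<in> K" for y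
  proof -
    define d where "d = y - c"
    have "y - c1 = d + e" "y - c2 = d + (- e)" by (simp_all add: d_def ce)
    then have "(d + e) \<bullet> (Q *v (d + e)) \<le> 1" "(d + (- e)) \<bullet> (Q *v (d + (- e))) \<le> 1"
      using that K by (auto simp: ellipsoid_def)
    then have "d \<bullet> (Q *v d) \<le> 1 - k"
      unfolding quad_expand[OF Q] neg by (simp add: k_def)
    \<comment> \<open>Scaling by \<open>1 + k\<close> rather than by the reciprocal of
      \<open>1 - k\<close> requires no bound \<open>k < 1\<close>.\<close>
    then have "(1 + k) * (d \<bullet> (Q *v d)) \<le> (1 + k) * (1 - k)" using k by (intro mult_left_mono) auto
    also have "\<dots> \<le> 1" by (simp add: algebra_simps)
    finally show ?thesis by (simp add: ellipsoid_def d_def scaleR_matrix_vector)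
  qed
  moreover have "sym_pos_def ((1 + k) *\<^sub>R Q)"
    using Q k by (simp add: sym_pos_def_def transpose_scalar scaleR_matrix_vector)
  ultimately have "(1 + k) ^ CARD('n) * det Q \<le> 1 * det Q"
    using max[of "(1 + k) *\<^sub>R Q" c] by (auto simp: det_scaleR)
  then have "(1 + k) ^ CARD('n) \<le> 1" using sym_pos_def_det_pos[OF Q] by simp
  moreover have "1 < (1 + k) ^ CARD('n)" using k by (intro one_less_power) auto
  ultimately show False by simp
qed

lemma ellipsoid_gram_affine:
  fixes N :: "real^'n^'n"
  assumes "invertible N"
  obtains c where "\<And>y. y \<in> ellipsoid c (transpose N ** N) \<longleftrightarrow> norm (N *v y + b) \<le> 1"
proof -
  obtain R where R: "N ** R = mat 1" using assms unfolding invertible_def by blast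
  have "N *v (y - (- (R *v b))) = N *v y + b" for y
    by (simp add: matrix_vector_right_distrib matrix_vector_mul_assoc R)
  then show ?thesis using that[of "- (R *v b)"] by (simp add: ellipsoid_gram)
qed

lemma ellipsoid_gram_subset_iff:
  "K \<subseteq> ellipsoid c (transpose N ** N) \<longleftrightarrow> (\<forall>y\<in>K. N *v y + (- (N *v c)) \<in> cball 0 1)"
  by (auto simp: ellipsoid_gram matrix_vector_mult_diff_distrib)

lemma sym_pos_def_gram_factor:
  fixes Q :: "real^'n^'n"
  assumes "sym_pos_def Q"
  obtains N :: "real^'n^'n" where "invertible N" "Q = transpose N ** N"
proof -
  obtain L :: "real^'n^'n" where "invertible L" "Q = L ** transpose L"
    using sym_pos_def_factor[OF assms] by blast
  then show ?thesis using that[of "transpose L"] by (simp add: transpose_invertible)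
qed

text \<open>Here the affine maps send \<open>K\<close> into the unit ball, and small volume means
  large \<open>det Q\<close>. For uniqueness, the midpoint of two optimal matrices first forces the
  matrices to agree, then \<open>enclosing_center_unique\<close> treats the centers.\<close>

lemma MinCE_eq:
  fixes K :: "(real^'n) set"
  assumes bdd: "bounded K" and int: "interior K \<noteq> {}"
  obtains c Q where "sym_pos_def Q" "K \<subseteq> ellipsoid c Q" "MinCE K = ellipsoid c Q"
    "\<forall>c' Q'. sym_pos_def Q' \<and> K \<subseteq> ellipsoid c' Q' \<longrightarrow> det Q' \<le> det Q"
proof -
  obtain \<tau> where \<tau>: "\<tau> > 0" "\<And>y. y \<in> K \<Longrightarrow> norm y \<le> \<tau>"
    using bdd by (auto simp: bounded_pos)
  have start: "((1 / \<tau>) *\<^sub>R mat 1) *v y + 0 \<in> cball 0 1" if "y \<in> K" for y :: "real^'n"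
    using \<tau> that by (simp add: scaleR_matrix_vector)
  obtain N b where feas: "\<And>y. y \<in> K \<Longrightarrow> N *v y + b \<in> cball 0 1"
    and max: "\<And>N' b'. (\<And>y. y \<in> K \<Longrightarrow> N' *v y + b' \<in> cball 0 1) \<Longrightarrow> \<bar>det N'\<bar> \<le> \<bar>det N\<bar>"
    using ex_max_det_affine[OF compact_cball int start] by blast
  have "0 < \<bar>det ((1 / \<tau>) *\<^sub>R mat 1 :: real^'n^'n)\<bar>" using \<tau> by (simp add: det_scaleR)
  also have "\<dots> \<le> \<bar>det N\<bar>" using max[of "(1 / \<tau>) *\<^sub>R mat 1" 0] start by blast
  finally have N: "invertible N" by (simp add: invertible_det_nz)
  define Q where "Q = transpose N ** N"
  have Q: "sym_pos_def Q" unfolding Q_def using N by (rule sym_pos_def_gram)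
  obtain c where c: "\<And>y. y \<in> ellipsoid c Q \<longleftrightarrow> norm (N *v y + b) \<le> 1"
    unfolding Q_def using ellipsoid_gram_affine[OF N] by blast
  have K: "K \<subseteq> ellipsoid c Q" using feas c by auto
  have maxQ: "det Q' \<le> det Q" if Q': "sym_pos_def Q'" "K \<subseteq> ellipsoid c' Q'" for c' Q'
  proof -
    obtain N' :: "real^'n^'n" where N': "invertible N'" "Q' = transpose N' ** N'"
      using sym_pos_def_gram_factor[OF Q'(1)] by blast
    have "\<bar>det N'\<bar> \<le> \<bar>det N\<bar>"
      using Q'(2) unfolding N' ellipsoid_gram_subset_iff by (intro max) blast
    then have "(det N')\<^sup>2 \<le> (det N)\<^sup>2" by (simp add: abs_le_square_iff)
    then show ?thesis by (simp add: Q_def N' det_mul power2_eq_square)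
  qed
  have "MinCE K = ellipsoid c Q"
    unfolding MinCE_def
  proof (rule the_equality)
    show "is_ellipsoid (ellipsoid c Q) \<and> K \<subseteq> ellipsoid c Q \<and>
      (\<forall>F. is_ellipsoid F \<and> K \<subseteq> F \<longrightarrow> ell_vol (ellipsoid c Q) \<le> ell_vol F)"
      using Q K maxQ by (auto simp: is_ellipsoid_def ell_vol_le_iff)
  next
    fix E assume E: "is_ellipsoid E \<and> K \<subseteq> E \<and>
      (\<forall>F. is_ellipsoid F \<and> K \<subseteq> F \<longrightarrow> ell_vol E \<le> ell_vol F)"
    then obtain c' Q' where Q': "sym_pos_def Q'" "E = ellipsoid c' Q'"
      unfolding is_ellipsoid_def by blast
    have K': "K \<subseteq> ellipsoid c' Q'" using E Q' by blast
    have "ell_vol E \<le> ell_vol (ellipsoid c Q)" using E K Q unfolding is_ellipsoid_def by blast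
    then have eq: "det Q' = det Q" using maxQ[OF Q'(1) K'] by (simp add: Q' Q ell_vol_le_iff)
    have "Q' = Q"
    proof (rule ccontr)
      assume "Q' \<noteq> Q"
      then have "det Q' < det ((1/2) *\<^sub>R (Q' + Q))" using det_midpoint_strict[OF Q'(1) Q eq] by blast
      moreover obtain c'' where "K \<subseteq> ellipsoid c'' ((1/2) *\<^sub>R (Q' + Q))"
        using enclosing_midpoint[OF Q'(1) Q K' K] by blast
      ultimately show False using maxQ sym_pos_def_midpoint[OF Q'(1) Q] eq by fastforce
    qed
    moreover have "c' = c"
      using K' \<open>Q' = Q\<close> by (intro enclosing_center_unique[OF Q _ K maxQ]) simp_all
    ultimately show "E = ellipsoid c Q" by (simp add: Q')
  qed
  with maxQ show ?thesis by (intro that[OF Q K]) auto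
qed

subsection \<open>Polarity\<close>

lemma interior_polar_less:
  assumes "x \<in> interior (polar A)" "a \<in> A"
  shows "a \<bullet> x < 1"
proof (cases "a = 0")
  case False
  obtain r where r: "r > 0" "cball x r \<subseteq> polar A" using assms(1) by (auto simp: mem_interior_cball)
  have "x + (r / norm a) *\<^sub>R a \<in> cball x r" using r False by (simp add: dist_norm)
  then have "(x + (r / norm a) *\<^sub>R a) \<bullet> a \<le> 1" using r assms(2) by (auto simp: polar_def)
  moreover have "0 < (r / norm a) * (a \<bullet> a)" using r False by simp
  moreover have "(x + (r / norm a) *\<^sub>R a) \<bullet> a = a \<bullet> x + (r / norm a) * (a \<bullet> a)"
    by (simp add: inner_add_left inner_commute[of x a])
  ultimately show ?thesis by linarith
qed simp

lemma interior_polar_of_bounded: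
  fixes S :: "(real^'n) set"
  assumes "bounded S"
  shows "0 \<in> interior (polar S)"
proof -
  obtain \<tau> where \<tau>: "\<tau> > 0" "\<And>s. s \<in> S \<Longrightarrow> norm s \<le> \<tau>" using assms by (auto simp: bounded_pos)
  have "cball 0 (1 / \<tau>) \<subseteq> polar S"
  proof
    fix y :: "real^'n" assume y: "y \<in> cball 0 (1 / \<tau>)"
    have "y \<bullet> s \<le> 1" if "s \<in> S" for s
    proof -
      have "y \<bullet> s \<le> norm y * norm s" by (rule norm_cauchy_schwarz)
      also have "\<dots> \<le> (1 / \<tau>) * \<tau>" using y \<tau> that by (intro mult_mono) auto
      finally show ?thesis using \<tau> by simp
    qed
    then show "y \<in> polar S" by (simp add: polar_def)
  qed
  then show ?thesis using \<tau> by (auto simp: mem_interior_cball intro!: exI[of _ "1 / \<tau>"])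
qed

lemma bounded_polar_of_interior:
  assumes "0 \<in> interior S"
  shows "bounded (polar S)"
proof -
  obtain r where r: "r > 0" "cball 0 r \<subseteq> S" using assms by (auto simp: mem_interior_cball)
  have "norm y \<le> 1 / r" if "y \<in> polar S" for y
  proof (cases "y = 0")
    case False
    have "(r / norm y) *\<^sub>R y \<in> S" using r False by (intro subsetD[OF r(2)]) simp
    then have "y \<bullet> ((r / norm y) *\<^sub>R y) \<le> 1" using that by (auto simp: polar_def)
    then have "r * norm y \<le> 1" using False by (simp add: dot_square_norm power2_eq_square)
    then show ?thesis using r by (simp add: field_simps)
  qed (use r in simp)
  then show ?thesis unfolding bounded_iff by blast
qed

lemma zero_in_interior_translate:
  "x \<in> interior P \<Longrightarrow> 0 \<in> interior ((\<lambda>p. p - x) ` P)" for P :: "(real^'n) set"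
  by (simp add: interior_translation_subtract)

section \<open>From ellipsoids around the polar body to inscribed ellipsoids, and back\<close>

text \<open>Completing the square turns the inequality of an off-center ellipsoid, evaluated at a
  constraint vector, into a bound on a half-width. The sign of \<open>f\<close> ensures that the
  right side is nonnegative.\<close>

lemma sqrt_le_from_shifted_square:
  fixes f g s \<beta> :: real
  assumes s: "s > 0" and \<beta>: "\<beta> > 0" and f: "f \<ge> 0" and le: "f + 2 * s * g \<le> \<beta> * s\<^sup>2"
  shows "sqrt (f / \<beta> + g\<^sup>2 / \<beta>\<^sup>2) \<le> s - g / \<beta>"
proof (rule real_le_lsqrt)
  have "s * (2 * g) \<le> s * (\<beta> * s)" using le f by (simp add: power2_eq_square mult_ac)
  then have "2 * g \<le> \<beta> * s" using s by simp
  then have "g / \<beta> \<le> s / 2" using \<beta> by (simp add: field_simps)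
  then show "0 \<le> s - g / \<beta>" using s by linarith
  have "f / \<beta> \<le> s\<^sup>2 - 2 * s * g / \<beta>" using le \<beta> by (simp add: field_simps)
  then show "f / \<beta> + g\<^sup>2 / \<beta>\<^sup>2 \<le> (s - g / \<beta>)\<^sup>2"
    by (simp add: power2_diff power_divide algebra_simps)
qed

text \<open>The polar of the enclosing ellipsoid, translated by \<open>x\<close>, is inscribed in
  \<open>polar A\<close>. If the enclosing ellipsoid is off-center by \<open>b\<close>, then with
  \<beta> = 1 - |b|^2 the determinant is multiplied by the power -(n + 1) of \<beta>, while the
  center moves by \<open>w\<close> with |w| at most \<rho> |b|; hence a displaced center costs a
  quadratic factor.\<close>

lemma inscribed_of_enclosing:
  fixes A :: "(real^'n) set"
  assumes x: "x \<in> interior (polar A)" and \<rho>: "\<rho> > 0" "polar A \<subseteq> cball 0 \<rho>"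
    and Q: "sym_pos_def Q" and K: "polar ((\<lambda>p. p - x) ` polar A) \<subseteq> ellipsoid d Q"
  obtains c S where "inscribed A c S" "det Q \<le> det S * (1 - (norm (c - x))\<^sup>2 / \<rho>\<^sup>2)"
proof -
  let ?K = "polar ((\<lambda>p. p - x) ` polar A)"
  obtain N :: "real^'n^'n" where N: "invertible N" "Q = transpose N ** N"
    using sym_pos_def_gram_factor[OF Q] by blast
  define b where "b = - (N *v d)"
  have Kb: "norm (N *v y + b) \<le> 1" if "y \<in> ?K" for y
    using K that unfolding N ellipsoid_gram_subset_iff by (auto simp: b_def)
  \<comment> \<open>The origin is interior to \<open>?K\<close>, so a small step from it along the
    preimage \<open>R *v b\<close> stays in the ellipsoid and replaces \<open>b\<close> by
    \<open>(1 + \<epsilon>) *\<^sub>R b\<close>.\<close>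
  have b1: "norm b < 1"
  proof (cases "b = 0")
    case False
    have "bounded ((\<lambda>p. p - x) ` polar A)"
      using bounded_subset[OF bounded_cball \<rho>(2)] by (rule bounded_translation_minus)
    then obtain r where r: "r > 0" "cball 0 r \<subseteq> ?K"
      using interior_polar_of_bounded mem_interior_cball by metis
    obtain R where R: "N ** R = mat 1" using N unfolding invertible_def by blast
    define \<epsilon> where "\<epsilon> = r / (norm (R *v b) + 1)"
    have \<epsilon>: "\<epsilon> > 0" using r by (simp add: \<epsilon>_def add_nonneg_pos)
    have "norm (\<epsilon> *\<^sub>R (R *v b)) \<le> r"
      using r by (simp add: \<epsilon>_def pos_divide_le_eq add_nonneg_pos distrib_left)
    then have "norm (N *v (\<epsilon> *\<^sub>R (R *v b)) + b) \<le> 1" using r by (intro Kb) auto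
    then have "norm ((1 + \<epsilon>) *\<^sub>R b) \<le> 1"
      by (simp add: matrix_vector_mult_scaleR matrix_vector_mul_assoc R scaleR_add_left add.commute)
    then have "(1 + \<epsilon>) * norm b \<le> 1" using \<epsilon> by simp
    moreover have "norm b < (1 + \<epsilon>) * norm b" using \<epsilon> False by simp
    ultimately show ?thesis by linarith
  qed simp
  \<comment> \<open>The polar of \<open>{y. norm (N *v y + b) \<le> 1}\<close> is \<open>w + {S *v u | u. u \<bullet> (S *v u) \<le> 1}\<close>
    with the \<open>S\<close> and \<open>w\<close> below.\<close>
  define \<beta> where "\<beta> = 1 - b \<bullet> b"
  have "(norm b)\<^sup>2 < 1" using b1 by (simp add: power_less_one_iff abs_square_less_1)
  then have \<beta>: "\<beta> > 0" "\<beta> \<le> 1" by (simp_all add: \<beta>_def dot_square_norm)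
  define M where "M = (1 / sqrt \<beta>) *\<^sub>R transpose N"
  define S where "S = M ** (mat 1 + outer ((1 / sqrt \<beta>) *\<^sub>R b)) ** transpose M"
  define w where "w = (1 / \<beta>) *\<^sub>R (transpose N *v b)"
  define c where "c = x + w"
  have Sq: "u \<bullet> (S *v u) = (norm (N *v u))\<^sup>2 / \<beta> + ((N *v u) \<bullet> b)\<^sup>2 / \<beta>\<^sup>2" for u
  proof -
    have "transpose M *v u = (1 / sqrt \<beta>) *\<^sub>R (N *v u)"
      by (simp add: M_def transpose_scalar scaleR_matrix_vector)
    then show ?thesis
      using \<beta> by (simp add: S_def matrix_vector_mul_assoc[symmetric] inner_matrix_vector_transpose[of u M]
          matrix_vector_mult_add_rdistrib inner_add_right inner_commute[of b] dot_square_norm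
          power_divide power2_eq_square field_simps)
  qed
  have "invertible M" using N \<beta> unfolding M_def by (simp add: scalar_invertible transpose_invertible)
  then have "sym_pos_def S"
    using sym_pos_def_congruence[OF _ sym_pos_def_add_outer[OF sym_pos_def_one], of "transpose M"]
    by (simp add: S_def transpose_invertible)
  moreover have "a \<bullet> c + sqrt (a \<bullet> (S *v a)) \<le> 1" if a: "a \<in> A" for a
  proof -
    define s where "s = 1 - a \<bullet> x"
    have s: "s > 0" using interior_polar_less[OF x a] by (simp add: s_def)
    \<comment> \<open>The constraint vector \<open>a\<close>, rescaled by its slack at
      \<open>x\<close>, belongs to the polar of the translated body; the ellipsoid inequality at
      this point is the required support condition in disguise.\<close>
    have "(1 / s) *\<^sub>R a \<in> ?K"
    proof -
      have "a \<bullet> p - a \<bullet> x \<le> s" if "p \<in> polar A" for p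
        using that a by (auto simp: polar_def s_def inner_commute)
      then show ?thesis
        using s by (auto simp: polar_def inner_diff_right diff_divide_distrib[symmetric] divide_le_eq)
    qed
    then have "norm (N *v ((1 / s) *\<^sub>R a) + b) \<le> 1" by (rule Kb)
    moreover have "N *v a + s *\<^sub>R b = s *\<^sub>R (N *v ((1 / s) *\<^sub>R a) + b)"
      using s by (simp add: matrix_vector_mult_scaleR scaleR_add_right)
    ultimately have "norm (N *v a + s *\<^sub>R b) \<le> s" using s by (simp add: mult_left_le)
    then have "(norm (N *v a + s *\<^sub>R b))\<^sup>2 \<le> s\<^sup>2" by (intro power_mono) auto
    moreover have "(norm (N *v a + s *\<^sub>R b))\<^sup>2 = (norm (N *v a))\<^sup>2 + 2 * s * ((N *v a) \<bullet> b) + (1 - \<beta>) * s\<^sup>2"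
      unfolding power2_norm_eq_inner
      by (simp add: inner_add_left inner_add_right inner_commute[of b "N *v a"]
          \<beta>_def power2_eq_square algebra_simps)
    ultimately have "(norm (N *v a))\<^sup>2 + 2 * s * ((N *v a) \<bullet> b) \<le> \<beta> * s\<^sup>2"
      by (simp add: algebra_simps)
    from sqrt_le_from_shifted_square[OF s \<beta>(1) _ this]
    have "sqrt (a \<bullet> (S *v a)) \<le> s - ((N *v a) \<bullet> b) / \<beta>" by (simp add: Sq)
    moreover have "a \<bullet> c = a \<bullet> x + ((N *v a) \<bullet> b) / \<beta>"
      by (simp add: c_def w_def inner_add_right inner_matrix_vector_transpose[of a "transpose N"])
    ultimately show ?thesis by (simp add: s_def)
  qed
  ultimately have ins: "inscribed A c S" by (simp add: inscribed_def)
  have "det S = (1 / sqrt \<beta>) ^ CARD('n) * (1 / sqrt \<beta>) ^ CARD('n) * det Q * (1 + (b \<bullet> b) / \<beta>)"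
    using \<beta> by (simp add: S_def M_def det_congruence det_scaleR det_one_add_outer N det_mul power2_eq_square)
  also have "(1 / sqrt \<beta>) ^ CARD('n) * (1 / sqrt \<beta>) ^ CARD('n) = (1 / \<beta>) ^ CARD('n)"
    using \<beta> by (simp add: power_mult_distrib[symmetric] power_divide)
  also have "1 + (b \<bullet> b) / \<beta> = 1 / \<beta>" using \<beta> by (simp add: \<beta>_def field_simps)
  finally have "det S * \<beta> = (1 / \<beta>) ^ CARD('n) * det Q" using \<beta> by simp
  \<comment> \<open>Of the powers of \<open>1 / \<beta>\<close> in \<open>det S\<close> a single one
    is kept, which suffices for a quadratic loss.\<close>
  moreover have "1 \<le> (1 / \<beta>) ^ CARD('n)" using \<beta> by (intro one_le_power) simp
  ultimately have dQ: "det Q \<le> det S * \<beta>"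
    using sym_pos_def_det_pos[OF Q] by (simp add: mult_le_cancel_right1)
  have "(norm w)\<^sup>2 \<le> \<rho>\<^sup>2 * (b \<bullet> b)"
  proof (cases "w = 0")
    case False
    define n where "n = w \<bullet> w"
    have n: "n > 0" using False by (simp add: n_def)
    have bNw: "(N *v w) \<bullet> b = \<beta> * n"
    proof -
      have "(N *v w) \<bullet> b = w \<bullet> (transpose N *v b)"
        by (simp add: inner_matrix_vector_transpose[of w "transpose N"])
      also have "transpose N *v b = \<beta> *\<^sub>R w" using \<beta> by (simp add: w_def)
      finally show ?thesis by (simp add: n_def)
    qed
    have cs: "(\<beta> * n)\<^sup>2 \<le> (norm (N *v w))\<^sup>2 * (b \<bullet> b)"
      using Cauchy_Schwarz_ineq[of "N *v w" b] by (simp add: bNw dot_square_norm)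
    \<comment> \<open>Writing 1 as \<open>\<beta> + b \<bullet> b\<close> splits n^2 into two
      summands that match those of \<open>Sq\<close> at \<open>w\<close>; the bound on the form of
      \<open>S\<close> then cancels one factor \<open>n\<close>.\<close>
    have "n * n = (\<beta> + b \<bullet> b) * n\<^sup>2" by (simp add: \<beta>_def power2_eq_square)
    also have "\<dots> = (\<beta> * n)\<^sup>2 / \<beta> + n\<^sup>2 * (b \<bullet> b)" using \<beta> by (simp add: power2_eq_square field_simps)
    also have "\<dots> \<le> (norm (N *v w))\<^sup>2 * (b \<bullet> b) / \<beta> + n\<^sup>2 * (b \<bullet> b)"
      using cs \<beta> by (intro add_right_mono divide_right_mono) auto
    also have "\<dots> = (w \<bullet> (S *v w)) * (b \<bullet> b)"
      using \<beta> unfolding Sq bNw by (simp add: power_mult_distrib distrib_right)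
    also have "\<dots> \<le> (\<rho>\<^sup>2 * n) * (b \<bullet> b)"
      using inscribed_bounds(2)[OF ins \<rho>(2), of w] by (intro mult_right_mono) (auto simp: n_def)
    finally have "n * n \<le> n * (\<rho>\<^sup>2 * (b \<bullet> b))" by (simp add: mult_ac)
    then have "n \<le> \<rho>\<^sup>2 * (b \<bullet> b)" using n by simp
    then show ?thesis by (simp add: n_def dot_square_norm)
  qed simp
  then have "\<beta> \<le> 1 - (norm (c - x))\<^sup>2 / \<rho>\<^sup>2"
    using \<rho> by (simp add: \<beta>_def c_def divide_le_eq mult.commute)
  then have "det S * \<beta> \<le> det S * (1 - (norm (c - x))\<^sup>2 / \<rho>\<^sup>2)"
    using sym_pos_def_det_pos[OF \<open>sym_pos_def S\<close>] by (intro mult_left_mono) auto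
  with dQ have "det Q \<le> det S * (1 - (norm (c - x))\<^sup>2 / \<rho>\<^sup>2)" by linarith
  with ins show ?thesis by (rule that)
qed

text \<open>Polarity reverses inclusion and inverts the shape matrix. It suffices to test
  \<open>y\<close> against the point of the inscribed ellipsoid that is extremal in direction
  \<open>y\<close>.\<close>

lemma inscribed_polar_subset:
  fixes A :: "(real^'n) set"
  assumes "inscribed A c S"
  shows "polar ((\<lambda>p. p - c) ` polar A) \<subseteq> ellipsoid 0 S"
proof
  fix y assume y: "y \<in> polar ((\<lambda>p. p - c) ` polar A)"
  obtain L :: "real^'n^'n" where L: "invertible L" "S = L ** transpose L" "affine_ball c L \<subseteq> polar A"
    using assms by (rule inscribed_factor)
  let ?v = "transpose L *v y"
  have "c + L *v ((1 / norm ?v) *\<^sub>R ?v) \<in> polar A"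
    using L(3) unfolding affine_ball_def by (auto simp: image_subset_iff)
  then have "y \<bullet> (c + L *v ((1 / norm ?v) *\<^sub>R ?v) - c) \<le> 1"
    using y unfolding polar_def[of "(\<lambda>p. p - c) ` polar A"] by blast
  then have "norm ?v \<le> 1"
    by (simp add: inner_matrix_vector_transpose[of y L] dot_square_norm power2_eq_square
        split: if_splits)
  then show "y \<in> ellipsoid 0 S"
    using ellipsoid_gram[of 0 "transpose L"] L(2) by simp
qed

section \<open>Quadratic growth of \<open>log_vol_polar\<close>\<close>

lemma log_vol_polar_eq:
  fixes A :: "(real^'n) set"
  assumes bdd: "bounded (polar A)" and x: "x \<in> interior (polar A)"
  obtains d Q where "sym_pos_def Q" "polar ((\<lambda>p. p - x) ` polar A) \<subseteq> ellipsoid d Q"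
    "\<forall>d' Q'. sym_pos_def Q' \<and> polar ((\<lambda>p. p - x) ` polar A) \<subseteq> ellipsoid d' Q' \<longrightarrow> det Q' \<le> det Q"
    "log_vol_polar (polar A) x = - ln (det Q) / 2"
proof -
  have 1: "bounded (polar ((\<lambda>p. p - x) ` polar A))"
    using x by (intro bounded_polar_of_interior zero_in_interior_translate)
  have "0 \<in> interior (polar ((\<lambda>p. p - x) ` polar A))"
    using bdd by (intro interior_polar_of_bounded) (simp add: bounded_translation_minus)
  then have 2: "interior (polar ((\<lambda>p. p - x) ` polar A)) \<noteq> {}" by blast
  obtain d Q where Q: "sym_pos_def Q" "polar ((\<lambda>p. p - x) ` polar A) \<subseteq> ellipsoid d Q"
    "MinCE (polar ((\<lambda>p. p - x) ` polar A)) = ellipsoid d Q"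
    "\<forall>d' Q'. sym_pos_def Q' \<and> polar ((\<lambda>p. p - x) ` polar A) \<subseteq> ellipsoid d' Q' \<longrightarrow> det Q' \<le> det Q"
    by (rule MinCE_eq[OF 1 2]) (rule that; assumption)
  have "log_vol_polar (polar A) x = - ln (det Q) / 2"
    using sym_pos_def_det_pos[OF Q(1)]
    by (simp add: log_vol_polar_def Q(3) ell_vol_ellipsoid[OF Q(1)] ln_powr)
  from that[OF Q(1,2,4) this] show ?thesis .
qed

text \<open>The polar of the maximal inscribed ellipsoid bounds the value at \<open>c0\<close> from
  above. At \<open>x\<close>, the optimal enclosing ellipsoid yields an inscribed one with center
  \<open>c\<close>: passing to it costs \<open>Y\<close>, quadratic in the distance from
  \<open>x\<close> to \<open>c\<close>, and comparing it with the maximal one costs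
  \<open>X\<close>, quadratic in the distance from \<open>c\<close> to \<open>c0\<close>.\<close>

lemma log_vol_polar_growth:
  fixes A :: "(real^'n) set"
  assumes \<rho>: "\<rho> > 0" "polar A \<subseteq> cball 0 \<rho>"
    and star: "inscribed A c0 S0" and max: "\<And>c S. inscribed A c S \<Longrightarrow> det S \<le> det S0"
    and c0: "c0 \<in> interior (polar A)" and x: "x \<in> interior (polar A)"
  shows "log_vol_polar (polar A) x - log_vol_polar (polar A) c0 \<ge> (norm (x - c0))\<^sup>2 / (32 * \<rho>\<^sup>2)"
proof -
  have bdd: "bounded (polar A)" using \<rho>(2) bounded_subset bounded_cball by blast
  have S0: "det S0 > 0" using star by (simp add: inscribed_def sym_pos_def_det_pos)
  obtain d0 Q0 where Q0: "sym_pos_def Q0" "polar ((\<lambda>p. p - c0) ` polar A) \<subseteq> ellipsoid d0 Q0"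
    "\<forall>d' Q'. sym_pos_def Q' \<and> polar ((\<lambda>p. p - c0) ` polar A) \<subseteq> ellipsoid d' Q' \<longrightarrow> det Q' \<le> det Q0"
    "log_vol_polar (polar A) c0 = - ln (det Q0) / 2"
    by (rule log_vol_polar_eq[OF bdd c0]) (rule that; assumption)
  have "det S0 \<le> det Q0"
    using Q0(3) inscribed_polar_subset[OF star] star by (simp add: inscribed_def)
  then have v0: "log_vol_polar (polar A) c0 \<le> - ln (det S0) / 2" using S0 by (simp add: Q0(4))
  obtain d Q where Q: "sym_pos_def Q" "polar ((\<lambda>p. p - x) ` polar A) \<subseteq> ellipsoid d Q"
    "\<forall>d' Q'. sym_pos_def Q' \<and> polar ((\<lambda>p. p - x) ` polar A) \<subseteq> ellipsoid d' Q' \<longrightarrow> det Q' \<le> det Q"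
    "log_vol_polar (polar A) x = - ln (det Q) / 2"
    by (rule log_vol_polar_eq[OF bdd x]) (rule that; assumption)
  obtain c S where cS: "inscribed A c S" "det Q \<le> det S * (1 - (norm (c - x))\<^sup>2 / \<rho>\<^sup>2)"
    by (rule inscribed_of_enclosing[OF x \<rho> Q(1,2)]) (rule that; assumption)
  have S: "det S > 0" using cS by (simp add: inscribed_def sym_pos_def_det_pos)
  define X where "X = (norm (c0 - c))\<^sup>2 / (8 * \<rho>\<^sup>2)"
  define Y where "Y = (norm (c - x))\<^sup>2 / \<rho>\<^sup>2"
  have X0: "X \<ge> 0" and Y0: "Y \<ge> 0" by (simp_all add: X_def Y_def)
  \<comment> \<open>Both centers lie in the ball of radius \<rho>. The bound 1/2 is what makes
    \<open>X - X\<^sup>2\<close>, and so \<open>ln (1 + X)\<close>, at least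
    \<open>X / 2\<close>.\<close>
  have X1: "X \<le> 1 / 2"
  proof -
    have "norm (c0 - c) \<le> 2 * \<rho>"
      using norm_triangle_ineq4[of c0 c] inscribed_bounds(1)[OF star \<rho>(2)]
        inscribed_bounds(1)[OF cS(1) \<rho>(2)] by linarith
    then have "(norm (c0 - c))\<^sup>2 \<le> (2 * \<rho>)\<^sup>2" by (intro power_mono) auto
    then show ?thesis using \<rho> by (simp add: X_def field_simps power2_eq_square)
  qed
  have "0 < det S * (1 - Y)" using sym_pos_def_det_pos[OF Q(1)] cS(2) unfolding Y_def by linarith
  then have Y1: "1 - Y > 0" using S by (simp add: zero_less_mult_iff)
  have "ln (det Q) \<le> ln (det S * (1 - Y))"
    using sym_pos_def_det_pos[OF Q(1)] cS(2) by (simp add: Y_def)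
  also have "\<dots> = ln (det S) + ln (1 - Y)" using S Y1 by (simp add: ln_mult)
  also have "\<dots> \<le> ln (det S) - Y" using ln_le_minus_one[OF Y1] by simp
  finally have lnQ: "ln (det Q) \<le> ln (det S) - Y" .
  have "det S * (1 + X)\<^sup>2 \<le> det S0"
    unfolding X_def by (rule inscribed_growth[OF star cS(1) _ \<rho>]) (rule max)
  moreover have "0 < det S * (1 + X)\<^sup>2" using S X0 by simp
  ultimately have "ln (det S * (1 + X)\<^sup>2) \<le> ln (det S0)" by simp
  moreover have "ln (det S * (1 + X)\<^sup>2) = ln (det S) + 2 * ln (1 + X)"
    using S X0 by (simp add: ln_mult ln_realpow)
  moreover have "X / 2 \<le> ln (1 + X)"
  proof -
    have "X / 2 \<le> X - X\<^sup>2" using X0 X1 mult_left_mono[OF X1 X0] by (simp add: power2_eq_square)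
    also have "\<dots> \<le> ln (1 + X)" using X0 X1 by (intro ln_one_plus_pos_lower_bound) auto
    finally show ?thesis .
  qed
  ultimately have lnS: "ln (det S) + X \<le> ln (det S0)" by linarith
  have "(norm (x - c0))\<^sup>2 \<le> 2 * (norm (c0 - c))\<^sup>2 + 2 * (norm (c - x))\<^sup>2"
  proof -
    have "norm (x - c0) \<le> norm (c0 - c) + norm (c - x)"
      using norm_triangle_ineq[of "c0 - c" "c - x"] by (simp add: norm_minus_commute)
    then have "(norm (x - c0))\<^sup>2 \<le> (norm (c0 - c) + norm (c - x))\<^sup>2" by (intro power_mono) auto
    also have "\<dots> \<le> 2 * (norm (c0 - c))\<^sup>2 + 2 * (norm (c - x))\<^sup>2"
      using zero_le_power2[of "norm (c0 - c) - norm (c - x)"] by (simp add: power2_diff power2_sum)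
    finally show ?thesis .
  qed
  \<comment> \<open>The 8 in the definition of \<open>X\<close> and the 2 from squaring the triangle
    inequality give 16; the 1/2 in the logarithm of the volume turns this into the 32 of the
    statement.\<close>
  also have "\<dots> = (16 * X + 2 * Y) * \<rho>\<^sup>2" using \<rho> by (simp add: X_def Y_def field_simps)
  also have "\<dots> \<le> (16 * X + 16 * Y) * \<rho>\<^sup>2" using Y0 by (intro mult_right_mono) simp_all
  finally have "(norm (x - c0))\<^sup>2 / (32 * \<rho>\<^sup>2) \<le> (X + Y) / 2"
    using \<rho> by (simp add: field_simps)
  also have "(X + Y) / 2 \<le> (ln (det S0) - ln (det Q)) / 2" using lnQ lnS by simp
  also have "\<dots> \<le> log_vol_polar (polar A) x - log_vol_polar (polar A) c0"
    using v0 by (simp add: Q(4) field_simps)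
  finally show ?thesis .
qed

lemma inscribed_center_interior:
  fixes A :: "(real^'n) set"
  assumes "inscribed A c S"
  shows "c \<in> interior (polar A)"
proof -
  obtain L :: "real^'n^'n" where L: "invertible L" "S = L ** transpose L" "affine_ball c L \<subseteq> polar A"
    using assms by (rule inscribed_factor)
  obtain N :: "real^'n^'n" where N: "N ** L = mat 1" using L unfolding invertible_def by blast
  define U where "U = {y. norm (N *v (y - c)) < 1}"
  have "open U"
    unfolding U_def by (intro open_Collect_less continuous_intros
        bounded_linear.continuous_on[OF matrix_vector_mul_bounded_linear])
  moreover have "c \<in> U" by (simp add: U_def)
  moreover have "U \<subseteq> polar A"
    using L(3) unfolding U_def affine_ball_eq_ellipsoid[OF N] ellipsoid_gram by force
  ultimately show ?thesis by (rule interiorI)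
qed

theorem proposition2:
  fixes a :: "nat \<Rightarrow> real^'n" and m :: nat and P :: "(real^'n) set" and x_star :: "real^'n"
  assumes "P = {x. \<forall>i\<in>{1..m}. a i \<bullet> x \<le> 1}"
    and "polytope P"
    and "aff_dim P = int CARD('n)"
    and "x_star = ell_center (MaxIE P)"
  shows "\<exists>r>0. \<exists>\<mu>>0. ball x_star r \<subseteq> interior P \<and>
    (\<forall>x\<in>ball x_star r.
       log_vol_polar P x - log_vol_polar P x_star \<ge> \<mu> * (norm (x - x_star))\<^sup>2)"
proof -
  let ?A = "a ` {1..m}"
  have P: "P = polar ?A" by (auto simp: assms(1) polar_def inner_commute)
  have bdd: "bounded (polar ?A)" using polytope_imp_bounded[OF assms(2)] P by simp
  have int: "interior (polar ?A) \<noteq> {}"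
  proof -
    have "affine hull P = UNIV" using assms(3) aff_dim_eq_full[of P] by simp
    then have "interior P = rel_interior P" using rel_interior_interior by metis
    moreover have "P \<noteq> {}" using assms(3) by auto
    ultimately show ?thesis
      using rel_interior_eq_empty[OF polytope_imp_convex[OF assms(2)]] P by simp
  qed
  obtain c S where cS: "inscribed ?A c S" "\<forall>c' S'. inscribed ?A c' S' \<longrightarrow> det S' \<le> det S"
    "ell_center (MaxIE (polar ?A)) = c"
    by (rule MaxIE_polar[OF bdd int]) (rule that; assumption)
  have c: "x_star = c" using assms(4) cS(3) P by simp
  obtain \<rho> where \<rho>: "\<rho> > 0" "polar ?A \<subseteq> cball 0 \<rho>"
    using bdd by (metis bounded_subset_ballD ball_subset_cball subset_trans)
  have cint: "c \<in> interior (polar ?A)" using cS(1) by (rule inscribed_center_interior)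
  \<comment> \<open>The growth bound holds on the whole interior, so any ball around the center that
    stays inside it will do.\<close>
  then obtain r where r: "r > 0" "ball c r \<subseteq> interior (polar ?A)"
    using open_contains_ball[of "interior (polar ?A)"] open_interior by blast
  have "1 / (32 * \<rho>\<^sup>2) * (norm (x - x_star))\<^sup>2 \<le> log_vol_polar P x - log_vol_polar P x_star"
    if "x \<in> ball x_star r" for x
  proof -
    have "x \<in> interior (polar ?A)" using that r c by blast
    from log_vol_polar_growth[OF \<rho> cS(1) _ cint this] cS(2) show ?thesis by (simp add: P c)
  qed
  moreover have "0 < 1 / (32 * \<rho>\<^sup>2)" using \<rho> by simp
  ultimately show ?thesis using r P c by blast
qed

end
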